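(* Let $\mu$ be the Gaussian measure on $\mathbb{R}^n$ or the exponential measure on $\mathbb{R}^n_+$ (see context), with moments $y_\alpha=\int\mathbf{x}^\alpha\,d\mu$. Let $\Omega=\{\mathbf{x}\in\mathbb{R}^n:g_j(\mathbf{x})\ge0,\ j=1,\dots,m\}$ with $g_j\in\mathbb{R}[\mathbf{x}]$; when $\mu$ is the exponential measure the constraints $x_i\ge0$, $i=1,\dots,n$, are among the constraints $g_j\ge0$. Let $\Omega^c=\operatorname{supp}\mu\setminus\Omega$ and assume that both $\Omega$ and $\Omega^c$ have nonempty interior. Let $\Omega^c_1,\dots,\Omega^c_s\subseteq\operatorname{supp}\mu$ be closed basic semi-algebraic sets $$\Omega^c_\ell=\{\mathbf{x}:g_{\ell j}(\mathbf{x})\ge0,\ j=1,\dots,m_\ell\},\qquad g_{\ell j}\in\mathbb{R}[\mathbf{x}],\ \ell=1,\dots,s,$$ such that $\Omega^c=\bigcup_{\ell=1}^s\Omega^c_\ell$ up to a set of $\mu$-measure zero, and whose pairwise overlaps have $\mu$-measure zero (so $\mu(\Omega^c)=\sum_\ell\mu(\Omega^c_\ell)$). Let $d_{\ell j}=\lceil\deg(g_{\ell j})/2\rceil$, $d_0=\max_{\ell,j}d_{\ell j}$. For $h\in\mathbb{R}[\mathbf{x}]$ and $d\ge d_0$ with $2d\ge\deg h$, let $$\overline{o}^c_{\ell d}(h)=\sup_{\mathbf{u},\mathbf{v}}\Big\{L_{\mathbf{u}}(h):u_\alpha+v_\alpha=y_\alpha\ \forall\alpha\in\mathbb{N}^n_{2d};\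 \mathbf{M}_d(\mathbf{u})\succeq0,\ \mathbf{M}_d(\mathbf{v})\succeq0;\ \mathbf{M}_{d-d_{\ell j}}(g_{\ell j}\,\mathbf{u})\succeq0,\ j=1,\dots,m_\ell\Big\}$$ over $\mathbf{u}=(u_\alpha)_{\alpha\in\mathbb{N}^n_{2d}}$, $\mathbf{v}=(v_\alpha)_{\alpha\in\mathbb{N}^n_{2d}}$. (a) Let $\underline{o}_d:=\mu(\mathbb{R}^n)-\sum_{\ell=1}^s\overline{o}^c_{\ell d}(1)$ for $d\ge d_0$. Then $(\underline{o}_d)$ is monotone non-decreasing, $\mu(\Omega)\ge\underline{o}_d$ for all $d\ge d_0$, and $\underline{o}_d\to\mu(\Omega)$ as $d\to\infty$. (b) Let $f\in\mathbb{R}[\mathbf{x}]$, $f\ne1$, vanish on the boundary $\partial\Omega$, and let $\underline{o}_d:=\int f^2\,d\mu-\sum_{\ell=1}^s\overline{o}^c_{\ell d}(f^2)$ for $d\ge d_0$ with $d\ge\deg f$. Then $(\underline{o}_d)$ is monotone non-decreasing, $\int_\Omega f^2\,d\mu\ge\underline{o}_d$ for all such $d$, and $\underline{o}_d\to\int_\Omega f^2\,d\mu$ as $d\to\infty$.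
   Context: Measures: the Gaussian measure is $\mu(B)=(2\pi)^{-n/2}\int_B\exp(-\|\mathbf{x}\|^2/2)\,d\mathbf{x}$ for Borel $B\subseteq\mathbb{R}^n$ (support $\mathbb{R}^n$); the exponential measure is $\mu(B)=(2\pi)^{-n/2}\int_B\exp(-\sum_{i=1}^n x_i)\,d\mathbf{x}$ for Borel $B\subseteq\mathbb{R}^n_+$, viewed as a measure on $\mathbb{R}^n$ with support $\mathbb{R}^n_+=\{\mathbf{x}:\mathbf{x}\ge0\}$. Notation: $\mathbb{N}^n_k=\{\alpha\in\mathbb{N}^n:\sum_i\alpha_i\le k\}$. For a (truncated) sequence $\mathbf{z}=(z_\alpha)$, $L_{\mathbf{z}}(\sum_\alpha f_\alpha\mathbf{x}^\alpha)=\sum_\alpha f_\alpha z_\alpha$. The moment matrix $\mathbf{M}_k(\mathbf{z})$ has rows and columns indexed by $\mathbb{N}^n_k$ and $(\alpha,\beta)$ entry $z_{\alpha+\beta}$; for $g=\sum_\gamma g_\gamma\mathbf{x}^\gamma$ the localizing matrix $\mathbf{M}_k(g\,\mathbf{z})$ has rows and columns indexed by $\mathbb{N}^n_k$ and $(\alpha,\beta)$ entry $\sum_\gamma g_\gamma z_{\alpha+\beta+\gamma}$. $\mathbf{A}\succeq0$ means the real symmetric matrix $\mathbf{A}$ is positive semidefinite. *)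

theory Defs
  imports "HOL-Analysis.Analysis" "HOL-Library.Poly_Mapping"
begin

text \<open>A type \<open>'n\<close> with \<open>n\<close> elements indexes the coordinates. Exponents are finitely supported
  maps \<open>'n \<Rightarrow>\<^sub>0 nat\<close>, and the ring of real polynomials in \<open>n\<close> variables is the monoid algebra
  provided by \<^theory>\<open>HOL-Library.Poly_Mapping\<close>.\<close>

type_synonym 'n expo = "'n \<Rightarrow>\<^sub>0 nat"
type_synonym 'n rpoly = "'n expo \<Rightarrow>\<^sub>0 real"

definition expo_deg :: "'n::finite expo \<Rightarrow> nat" where
  "expo_deg \<alpha> = (\<Sum>i\<in>UNIV. Poly_Mapping.lookup \<alpha> i)"

definition expo_upto :: "nat \<Rightarrow> 'n::finite expo set" where
  "expo_upto k = {\<alpha>. expo_deg \<alpha> \<le> k}"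

definition monom_eval :: "'n::finite expo \<Rightarrow> real^'n \<Rightarrow> real" where
  "monom_eval \<alpha> x = (\<Prod>i\<in>UNIV. (x $ i) ^ Poly_Mapping.lookup \<alpha> i)"

definition poly_eval :: "'n::finite rpoly \<Rightarrow> real^'n \<Rightarrow> real" where
  "poly_eval p x = (\<Sum>\<alpha>\<in>Poly_Mapping.keys p. Poly_Mapping.lookup p \<alpha> * monom_eval \<alpha> x)"

definition poly_var :: "'n::finite \<Rightarrow> 'n rpoly" where
  "poly_var i = Poly_Mapping.single (Poly_Mapping.single i 1) 1"

text \<open>The zero polynomial gets degree 0.\<close>

definition poly_deg :: "'n::finite rpoly \<Rightarrow> nat" where
  "poly_deg p = Max (insert 0 (expo_deg ` Poly_Mapping.keys p))"

definition half_deg :: "'n::finite rpoly \<Rightarrow> nat" where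
  "half_deg p = nat \<lceil>real (poly_deg p) / 2\<rceil>"

definition basic_semialg :: "nat \<Rightarrow> (nat \<Rightarrow> 'n::finite rpoly) \<Rightarrow> (real^'n) set" where
  "basic_semialg m g = {x. \<forall>j\<in>{1..m}. poly_eval (g j) x \<ge> 0}"

definition gaussian_measure :: "(real^'n::finite) measure" where
  "gaussian_measure =
     density lborel (\<lambda>x. ennreal ((2 * pi) powr (- real CARD('n) / 2) * exp (- (norm x)\<^sup>2 / 2)))"

definition nonneg_orthant :: "(real^'n::finite) set" where
  "nonneg_orthant = {x. \<forall>i. x $ i \<ge> 0}"

text \<open>The factor \<open>(2\<pi>)\<^bsup>-n/2\<^esup>\<close> is intended: this is not a probability measure.\<close>

definition exponential_measure :: "(real^'n::finite) measure" where
  "exponential_measure =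
     density lborel (\<lambda>x. ennreal ((2 * pi) powr (- real CARD('n) / 2) * exp (- (\<Sum>i\<in>UNIV. x $ i))
                                  * indicator nonneg_orthant x))"

definition measure_supp :: "'a::topological_space measure \<Rightarrow> 'a set" where
  "measure_supp M = {x. \<forall>U. open U \<and> x \<in> U \<longrightarrow> emeasure M U > 0}"

definition moment :: "(real^'n::finite) measure \<Rightarrow> 'n expo \<Rightarrow> real" where
  "moment M \<alpha> = (\<integral>x. monom_eval \<alpha> x \<partial>M)"

definition riesz :: "('n::finite expo \<Rightarrow> real) \<Rightarrow> 'n rpoly \<Rightarrow> real" where
  "riesz z p = (\<Sum>\<alpha>\<in>Poly_Mapping.keys p. Poly_Mapping.lookup p \<alpha> * z \<alpha>)"

text \<open>Matrices with rows and columns indexed by a finite set \<open>I\<close> are functions of two arguments,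
  of which only the values on \<open>I \<times> I\<close> matter.\<close>

definition psd_on :: "'i set \<Rightarrow> ('i \<Rightarrow> 'i \<Rightarrow> real) \<Rightarrow> bool" where
  "psd_on I A \<longleftrightarrow> (\<forall>i\<in>I. \<forall>j\<in>I. A i j = A j i) \<and>
                 (\<forall>c. (\<Sum>i\<in>I. \<Sum>j\<in>I. c i * A i j * c j) \<ge> 0)"

definition moment_matrix :: "('n::finite expo \<Rightarrow> real) \<Rightarrow> 'n expo \<Rightarrow> 'n expo \<Rightarrow> real" where
  "moment_matrix z \<alpha> \<beta> = z (\<alpha> + \<beta>)"

definition localizing_matrix ::
    "'n::finite rpoly \<Rightarrow> ('n expo \<Rightarrow> real) \<Rightarrow> 'n expo \<Rightarrow> 'n expo \<Rightarrow> real" where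
  "localizing_matrix g z \<alpha> \<beta> =
     (\<Sum>\<gamma>\<in>Poly_Mapping.keys g. Poly_Mapping.lookup g \<gamma> * z (\<alpha> + \<beta> + \<gamma>))"

text \<open>Truncated sequences are represented by total functions: for \<open>d \<ge> half_deg (g j)\<close> the
  constraints only involve their values at exponents of degree at most \<open>2d\<close>.\<close>

definition relax_feasible ::
    "(real^'n::finite) measure \<Rightarrow> nat \<Rightarrow> (nat \<Rightarrow> 'n rpoly) \<Rightarrow> nat \<Rightarrow>
     ('n expo \<Rightarrow> real) \<Rightarrow> ('n expo \<Rightarrow> real) \<Rightarrow> bool" where
  "relax_feasible M m g d u v \<longleftrightarrow>
     (\<forall>\<alpha>\<in>expo_upto (2 * d). u \<alpha> + v \<alpha> = moment M \<alpha>) \<and>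
     psd_on (expo_upto d) (moment_matrix u) \<and>
     psd_on (expo_upto d) (moment_matrix v) \<and>
     (\<forall>j\<in>{1..m}. psd_on (expo_upto (d - half_deg (g j))) (localizing_matrix (g j) u))"

text \<open>The supremum is taken in the reals. For the measures above, \<open>d \<ge> half_deg (g j)\<close> and
  \<open>2d \<ge> poly_deg h\<close>, the set is nonempty (take the moments of the restrictions of \<open>M\<close> to
  \<open>basic_semialg m g\<close> and to its complement) and bounded (both moment matrices are positive
  semidefinite and their sum is fixed).\<close>

definition relax_sup ::
    "(real^'n::finite) measure \<Rightarrow> nat \<Rightarrow> (nat \<Rightarrow> 'n rpoly) \<Rightarrow> nat \<Rightarrow> 'n rpoly \<Rightarrow> real" where
  "relax_sup M m g d h = Sup {riesz u h | u v. relax_feasible M m g d u v}"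

lemma emeasure_density_pos:
  fixes h :: "real^'n::finite \<Rightarrow> real"
  assumes h: "h \<in> borel_measurable borel" and "open U" "open V" "V \<noteq> {}" "V \<subseteq> U"
    and pos: "\<And>x. x \<in> V \<Longrightarrow> h x > 0"
  shows "emeasure (density lborel (\<lambda>x. ennreal (h x))) U > 0"
proof (rule ccontr)
  let ?D = "density lborel (\<lambda>x. ennreal (h x))"
  assume "\<not> emeasure ?D U > 0"
  hence "emeasure ?D V = 0"
    using emeasure_mono[of V U ?D] assms by auto
  hence "V \<in> null_sets ?D" using assms by auto
  hence "AE x in lborel. x \<in> V \<longrightarrow> ennreal (h x) = 0"
    using h null_sets_density_iff[of "\<lambda>x. ennreal (h x)" lborel V] by auto
  hence "AE x in lborel. x \<notin> V"
    by (rule AE_mp) (use pos in \<open>auto simp: ennreal_eq_0_iff dest: leD\<close>)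
  hence "V \<in> null_sets lborel"
    using assms by (simp add: AE_iff_null_sets)
  hence "negligible V"
    by (simp add: negligible_iff_null_sets null_sets_completionI)
  thus False using open_not_negligible assms by blast
qed

lemma measure_supp_gaussian: "measure_supp (gaussian_measure :: (real^'n::finite) measure) = UNIV"
proof -
  have "emeasure (gaussian_measure :: (real^'n) measure) U > 0" if "open U" "x \<in> U" for U x
    unfolding gaussian_measure_def
    by (rule emeasure_density_pos[where V = U]) (use that in auto)
  thus ?thesis by (auto simp: measure_supp_def)
qed

lemma measure_supp_exponential:
  "measure_supp (exponential_measure :: (real^'n::finite) measure) = nonneg_orthant"
proof -
  have orth: "nonneg_orthant = (\<Inter>i. {x::real^'n. 0 \<le> x $ i})"
    by (auto simp: nonneg_orthant_def)
  have cl: "closed (nonneg_orthant :: (real^'n) set)"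
    unfolding orth by (intro closed_INT ballI closed_Collect_le continuous_intros)
  have meas: "(\<lambda>x::real^'n. (2 * pi) powr (- real CARD('n) / 2) * exp (- (\<Sum>i\<in>UNIV. x $ i))
                * indicator nonneg_orthant x) \<in> borel_measurable borel"
    using cl by (intro borel_measurable_times borel_measurable_continuous_onI borel_measurable_indicator
        continuous_intros) auto
  have pos: "emeasure (exponential_measure :: (real^'n) measure) U > 0"
    if U: "open U" "x \<in> U" and x: "x \<in> nonneg_orthant" for U and x :: "real^'n"
  proof -
    define P :: "(real^'n) set" where "P = (\<Inter>i. {x. 0 < x $ i})"
    have oP: "open P"
      unfolding P_def by (intro open_INT ballI open_Collect_less continuous_intros) auto
    have "((\<lambda>t. x + t *\<^sub>R (1::real^'n)) \<longlongrightarrow> x + 0 *\<^sub>R 1) (at_right 0)"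
      by (intro tendsto_intros)
    hence "\<forall>\<^sub>F t in at_right 0. x + t *\<^sub>R (1::real^'n) \<in> U"
      using U by (intro topological_tendstoD) auto
    moreover have "\<forall>\<^sub>F t::real in at_right 0. t > 0"
      by (simp add: eventually_at_right_less)
    ultimately have "\<forall>\<^sub>F t in at_right 0. x + t *\<^sub>R (1::real^'n) \<in> U \<inter> P"
    proof eventually_elim
      case (elim t)
      thus ?case using x by (auto simp: P_def nonneg_orthant_def intro: add_nonneg_pos)
    qed
    hence "\<exists>t. x + t *\<^sub>R (1::real^'n) \<in> U \<inter> P"
      by (rule eventually_happens'[OF trivial_limit_at_right_real])
    hence ne: "U \<inter> P \<noteq> {}" by blast
    show ?thesis
      unfolding exponential_measure_def
      by (rule emeasure_density_pos[where V = "U \<inter> P", OF meas])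
         (use U oP ne in \<open>auto simp: P_def nonneg_orthant_def less_imp_le\<close>)
  qed
  have "emeasure (exponential_measure :: (real^'n) measure) (- nonneg_orthant) = 0"
  proof -
    have "emeasure (exponential_measure :: (real^'n) measure) (- nonneg_orthant) =
       (\<integral>\<^sup>+ x. ennreal ((2 * pi) powr (- real CARD('n) / 2) * exp (- (\<Sum>i\<in>UNIV. x $ i))
                * indicator nonneg_orthant (x::real^'n)) * indicator (- nonneg_orthant) x \<partial>lborel)"
      unfolding exponential_measure_def by (rule emeasure_density) (use meas cl in auto)
    also have "\<dots> = (\<integral>\<^sup>+ x. 0 \<partial>(lborel :: (real^'n) measure))"
      by (intro nn_integral_cong) (auto simp: indicator_def)
    finally show ?thesis by simp
  qed
  moreover have "open (- nonneg_orthant :: (real^'n) set)" using cl by auto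
  ultimately show ?thesis using pos unfolding measure_supp_def by fastforce
qed

end

theory Submission
  imports Defs "HOL-Probability.Sinc_Integral"
begin

text \<open>
  Let \<open>K = {g\<^sub>1 \<ge> 0, \<dots>, g\<^sub>m \<ge> 0}\<close>. Any feasible \<open>u\<close> satisfies \<open>0 \<le> L\<^sub>u(p\<^sup>2) \<le> \<integral>p\<^sup>2 d\<mu>\<close>
  and \<open>L\<^sub>u(q\<^sup>2 g\<^sub>j) \<ge> 0\<close> for polynomials of small degree. So it suffices to find polynomials
  \<open>p\<close>, \<open>q\<^sub>j\<close> such that \<open>e = f\<^sup>2 - p\<^sup>2 + \<Sum>\<^sub>j q\<^sub>j\<^sup>2 g\<^sub>j\<close> is small in \<open>L\<^sup>2(\<mu>)\<close> and \<open>\<integral>p\<^sup>2 d\<mu>\<close> is close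
  to \<open>\<integral>\<^sub>K f\<^sup>2 d\<mu>\<close>: then
  \<open>L\<^sub>u(f\<^sup>2) = L\<^sub>u(e) + L\<^sub>u(p\<^sup>2) - \<Sum>\<^sub>j L\<^sub>u(q\<^sub>j\<^sup>2 g\<^sub>j) \<le> L\<^sub>u(e) + \<integral>p\<^sup>2 d\<mu>\<close>, and
  \<open>L\<^sub>u(e)\<close> is controlled by \<open>\<integral>e\<^sup>2 d\<mu>\<close>. Neither limits of feasible points nor representing
  measures are needed.

  Splitting the complement of \<open>K\<close> into disjoint Borel sets \<open>B\<^sub>j \<subseteq> {g\<^sub>j < 0}\<close>, one takes \<open>p\<close> close to
  \<open>f\<close> on \<open>K\<close> (and to 0 elsewhere) in \<open>L\<^sup>4(\<mu>)\<close>, and \<open>q\<^sub>j\<close> close to \<open>f / sqrt (- g\<^sub>j)\<close> on \<open>B\<^sub>j\<close>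
  in \<open>L\<^sup>4(g\<^sub>j\<^sup>2 \<mu>)\<close>.

  Polynomials are dense in these \<open>L\<^sup>4\<close> spaces: let \<open>V\<close> be their closure and call a bounded \<open>\<phi>\<close> a
  multiplier if \<open>\<phi> V \<subseteq> V\<close>. Multipliers form an algebra closed under bounded pointwise limits.
  With \<open>r\<close> the growth polynomial (\<open>|x|\<^sup>2\<close> or \<open>\<Sum>x\<^sub>i\<close>) and \<open>t > 0\<close> small, Taylor expansion shows that
  \<open>q \<cdot> exp (- t r)\<close> is a multiplier for every polynomial \<open>q\<close>. As \<open>x\<^sub>i > a\<close> iff
  \<open>(x\<^sub>i - a) exp (- t r) > 0\<close>, the indicators of half-spaces, hence of all Borel sets, are multipliers.
\<close>

section \<open>The Riesz functional and positive semidefiniteness\<close>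

lemma riesz_eq_sum:
  assumes "finite A" "Poly_Mapping.keys p \<subseteq> A"
  shows "riesz z p = (\<Sum>\<alpha>\<in>A. Poly_Mapping.lookup p \<alpha> * z \<alpha>)"
  unfolding riesz_def using assms
  by (intro sum.mono_neutral_left) (auto simp: in_keys_iff)

lemma riesz_zero [simp]: "riesz z 0 = 0"
  by (simp add: riesz_def)

lemma riesz_add: "riesz z (p + q) = riesz z p + riesz z q"
proof -
  let ?A = "Poly_Mapping.keys p \<union> Poly_Mapping.keys q"
  have "riesz z (p + q) = (\<Sum>\<alpha>\<in>?A. Poly_Mapping.lookup (p + q) \<alpha> * z \<alpha>)"
    by (intro riesz_eq_sum Poly_Mapping.keys_add) auto
  also have "\<dots> = riesz z p + riesz z q"
    by (simp add: riesz_eq_sum[of ?A] lookup_add distrib_right sum.distrib)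
  finally show ?thesis .
qed

lemma riesz_diff: "riesz z (p - q) = riesz z p - riesz z q"
  using riesz_add[of z "p - q" q] by simp

lemma riesz_sum: "riesz z (\<Sum>i\<in>I. p i) = (\<Sum>i\<in>I. riesz z (p i))"
  by (induction I rule: infinite_finite_induct) (auto simp: riesz_add)

lemma riesz_single: "riesz z (Poly_Mapping.single \<alpha> c) = c * z \<alpha>"
  by (cases "c = 0") (auto simp: riesz_def)

lemma rpoly_eq_sum_single:
  "(p :: 'n::finite rpoly) = (\<Sum>\<alpha>\<in>Poly_Mapping.keys p. Poly_Mapping.single \<alpha> (Poly_Mapping.lookup p \<alpha>))"
proof (rule poly_mapping_eqI)
  fix \<beta>
  have "(\<Sum>\<alpha>\<in>Poly_Mapping.keys p. Poly_Mapping.lookup (Poly_Mapping.single \<alpha> (Poly_Mapping.lookup p \<alpha>)) \<beta>)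
      = (\<Sum>\<alpha>\<in>Poly_Mapping.keys p. if \<alpha> = \<beta> then Poly_Mapping.lookup p \<alpha> else 0)"
    by (intro sum.cong) (auto simp: lookup_single when_def)
  thus "Poly_Mapping.lookup p \<beta> = Poly_Mapping.lookup
      (\<Sum>\<alpha>\<in>Poly_Mapping.keys p. Poly_Mapping.single \<alpha> (Poly_Mapping.lookup p \<alpha>)) \<beta>"
    by (simp add: lookup_sum in_keys_iff)
qed

lemma riesz_mult:
  "riesz z (p * q) = (\<Sum>\<alpha>\<in>Poly_Mapping.keys p. \<Sum>\<beta>\<in>Poly_Mapping.keys q.
     Poly_Mapping.lookup p \<alpha> * Poly_Mapping.lookup q \<beta> * z (\<alpha> + \<beta>))"
proof -
  have "p * q = (\<Sum>\<alpha>\<in>Poly_Mapping.keys p. \<Sum>\<beta>\<in>Poly_Mapping.keys q.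
      Poly_Mapping.single (\<alpha> + \<beta>) (Poly_Mapping.lookup p \<alpha> * Poly_Mapping.lookup q \<beta>))"
    by (subst rpoly_eq_sum_single[of p], subst rpoly_eq_sum_single[of q])
       (simp add: sum_product mult_single)
  thus ?thesis by (simp add: riesz_sum riesz_single)
qed

text \<open>The shifted sequence on the right is the one whose moment matrix is the localizing
  matrix of \<open>q\<close>. Nonnegativity of L_z on squares times \<open>q\<close> thus becomes a
  statement about an ordinary moment matrix.\<close>

lemma riesz_mult_localizing:
  "riesz z (p * q) = riesz (\<lambda>\<alpha>. \<Sum>\<gamma>\<in>Poly_Mapping.keys q. Poly_Mapping.lookup q \<gamma> * z (\<alpha> + \<gamma>)) p"
  unfolding riesz_mult by (simp add: riesz_def sum_distrib_left mult.assoc)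

lemma riesz_scale: "riesz z (Poly_Mapping.single 0 a * p) = a * riesz z p"
  by (simp add: riesz_mult_localizing riesz_single) (simp add: riesz_def)

lemma localizing_matrix_eq_moment_matrix:
  "localizing_matrix g z =
     moment_matrix (\<lambda>\<alpha>. \<Sum>\<gamma>\<in>Poly_Mapping.keys g. Poly_Mapping.lookup g \<gamma> * z (\<alpha> + \<gamma>))"
  by (intro ext) (simp add: localizing_matrix_def moment_matrix_def)

section \<open>Degrees, truncated index sets and positive semidefiniteness\<close>

lemma expo_deg_add: "expo_deg (\<alpha> + \<beta>) = expo_deg \<alpha> + expo_deg \<beta>"
  by (simp add: expo_deg_def lookup_add sum.distrib)

lemma expo_deg_le_poly_deg: "\<alpha> \<in> Poly_Mapping.keys p \<Longrightarrow> expo_deg \<alpha> \<le> poly_deg p"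
  unfolding poly_deg_def by (intro Max_ge) auto

lemma poly_deg_one [simp]: "poly_deg (1 :: 'n::finite rpoly) = 0"
  by (simp add: poly_deg_def expo_deg_def)

lemma keys_subset_expo_upto: "poly_deg p \<le> d \<Longrightarrow> Poly_Mapping.keys p \<subseteq> expo_upto d"
  by (auto simp: expo_upto_def dest: expo_deg_le_poly_deg)

lemma keys_square_subset_expo_upto:
  assumes "poly_deg p \<le> d"
  shows "Poly_Mapping.keys (p * p) \<subseteq> expo_upto (2 * d)"
proof
  fix \<gamma> assume "\<gamma> \<in> Poly_Mapping.keys (p * p)"
  then obtain \<alpha> \<beta> where "\<gamma> = \<alpha> + \<beta>" "\<alpha> \<in> Poly_Mapping.keys p" "\<beta> \<in> Poly_Mapping.keys p"
    using keys_mult[of p p] by blast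
  thus "\<gamma> \<in> expo_upto (2 * d)"
    using assms expo_deg_le_poly_deg[of \<alpha> p] expo_deg_le_poly_deg[of \<beta> p]
    by (simp add: expo_upto_def expo_deg_add)
qed

lemma finite_expo_upto: "finite (expo_upto d :: 'n::finite expo set)"
proof (rule finite_imageD)
  have "Poly_Mapping.lookup ` (expo_upto d :: 'n expo set) \<subseteq> (UNIV \<rightarrow>\<^sub>E {..d})"
  proof (intro image_subsetI PiE_I)
    fix \<alpha> :: "'n expo" and i assume "\<alpha> \<in> expo_upto d"
    moreover have "Poly_Mapping.lookup \<alpha> i \<le> expo_deg \<alpha>"
      unfolding expo_deg_def by (intro member_le_sum) auto
    ultimately show "Poly_Mapping.lookup \<alpha> i \<in> {..d}" by (simp add: expo_upto_def)
  qed auto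
  moreover have "finite (UNIV \<rightarrow>\<^sub>E {..d} :: ('n \<Rightarrow> nat) set)"
    by (intro finite_PiE) auto
  ultimately show "finite (Poly_Mapping.lookup ` (expo_upto d :: 'n expo set))"
    by (rule finite_subset)
  show "inj_on Poly_Mapping.lookup (expo_upto d :: 'n expo set)"
    by (auto intro: inj_onI simp: lookup_inject)
qed

text \<open>The value is the quadratic form of the moment matrix at the coefficient vector of
  \<open>p\<close>, padded with zeros up to \<open>expo_upto d\<close>.\<close>

lemma riesz_square_nonneg:
  assumes psd: "psd_on (expo_upto d) (moment_matrix z)" and deg: "poly_deg p \<le> d"
  shows "riesz z (p * p) \<ge> 0"
proof -
  let ?l = "Poly_Mapping.lookup p"
  have sub: "Poly_Mapping.keys p \<subseteq> expo_upto d" using deg by (rule keys_subset_expo_upto)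
  have "riesz z (p * p) = (\<Sum>\<alpha>\<in>expo_upto d. \<Sum>\<beta>\<in>expo_upto d. ?l \<alpha> * ?l \<beta> * z (\<alpha> + \<beta>))"
    unfolding riesz_mult using sub
    by (intro sum.mono_neutral_cong_left sum.mono_neutral_left finite_expo_upto ballI)
       (auto simp: in_keys_iff)
  also have "\<dots> = (\<Sum>\<alpha>\<in>expo_upto d. \<Sum>\<beta>\<in>expo_upto d. ?l \<alpha> * moment_matrix z \<alpha> \<beta> * ?l \<beta>)"
    by (simp add: moment_matrix_def mult_ac)
  also have "\<dots> \<ge> 0" using psd unfolding psd_on_def by blast
  finally show ?thesis .
qed

lemma psd_on_subset:
  fixes A :: "'a \<Rightarrow> 'a \<Rightarrow> real"
  assumes "psd_on J A" "I \<subseteq> J" "finite J"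
  shows "psd_on I A"
  unfolding psd_on_def
proof (intro conjI allI)
  show "\<forall>i\<in>I. \<forall>j\<in>I. A i j = A j i" using assms unfolding psd_on_def by blast
  fix c :: "'a \<Rightarrow> real"
  \<comment> \<open>A vector on the smaller index set is extended by zero, which leaves the
    quadratic form unchanged.\<close>
  let ?c = "\<lambda>i. if i \<in> I then c i else 0"
  have "(\<Sum>i\<in>I. \<Sum>j\<in>I. c i * A i j * c j) = (\<Sum>i\<in>J. \<Sum>j\<in>J. ?c i * A i j * ?c j)"
    using assms by (intro sum.mono_neutral_cong_left ballI) (auto intro!: sum.neutral)
  also have "\<dots> \<ge> 0"
    using assms(1) unfolding psd_on_def by (elim conjE allE[where x = ?c])
  finally show "(\<Sum>i\<in>I. \<Sum>j\<in>I. c i * A i j * c j) \<ge> 0" .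
qed

text \<open>All index sets shrink with the order, and principal submatrices inherit
  semidefiniteness. Monotonicity of the bounds in \<open>d\<close> rests on this.\<close>

lemma relax_feasible_antimono:
  assumes "relax_feasible M m g d u v" "d' \<le> d"
  shows "relax_feasible M m g d' u v"
proof -
  have sub: "expo_upto a \<subseteq> expo_upto b" if "a \<le> b" for a b
    using that by (auto simp: expo_upto_def)
  have "expo_upto (2 * d') \<subseteq> expo_upto (2 * d)" "expo_upto d' \<subseteq> expo_upto d"
    "\<And>j. expo_upto (d' - half_deg (g j)) \<subseteq> expo_upto (d - half_deg (g j))"
    using assms(2) by (auto intro!: sub simp: diff_le_mono)
  thus ?thesis using assms(1) unfolding relax_feasible_def
    by (metis (no_types, lifting) psd_on_subset finite_expo_upto subset_iff)
qed

section \<open>Formal polynomials and polynomial functions\<close>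

lemma monom_eval_add: "monom_eval (\<alpha> + \<beta>) x = monom_eval \<alpha> x * monom_eval \<beta> x"
  by (simp add: monom_eval_def lookup_add power_add prod.distrib)

text \<open>Evaluation at \<open>x\<close> is the Riesz functional of the moments of the Dirac mass
  at \<open>x\<close>, so the algebraic rules for \<open>riesz\<close> carry over to
  \<open>poly_eval\<close>.\<close>

lemma poly_eval_eq_riesz: "poly_eval p x = riesz (\<lambda>\<alpha>. monom_eval \<alpha> x) p"
  by (simp add: poly_eval_def riesz_def)

lemma poly_eval_add: "poly_eval (p + q) x = poly_eval p x + poly_eval q x"
  and poly_eval_diff: "poly_eval (p - q) x = poly_eval p x - poly_eval q x"
  and poly_eval_sum: "poly_eval (\<Sum>i\<in>I. P i) x = (\<Sum>i\<in>I. poly_eval (P i) x)"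
  by (simp_all add: poly_eval_eq_riesz riesz_add riesz_diff riesz_sum)

lemma poly_eval_mult: "poly_eval (p * q) x = poly_eval p x * poly_eval q x"
  by (simp add: poly_eval_eq_riesz riesz_mult monom_eval_add)
     (simp add: riesz_def sum_product mult_ac)

lemma poly_eval_single: "poly_eval (Poly_Mapping.single \<alpha> c) x = c * monom_eval \<alpha> x"
  by (simp add: poly_eval_eq_riesz riesz_single)

lemma poly_eval_const [simp]: "poly_eval (Poly_Mapping.single 0 c) x = c"
  by (simp add: poly_eval_single monom_eval_def)

lemma poly_eval_one [simp]: "poly_eval 1 x = 1"
  using poly_eval_const[of 1 x] by simp

lemma poly_eval_var [simp]: "poly_eval (poly_var i) x = x $ i"
proof -
  have "monom_eval (Poly_Mapping.single i 1) x = (\<Prod>j\<in>UNIV. if j = i then x $ j else 1)"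
    unfolding monom_eval_def by (intro prod.cong) (auto simp: lookup_single when_def)
  thus ?thesis by (simp add: poly_var_def poly_eval_single)
qed

lemma real_polynomial_function_component: "real_polynomial_function (\<lambda>x::real^'n. x $ i)"
  by (intro real_polynomial_function.intros(1) bounded_linear_vec_nth)

lemma real_polynomial_function_monom_eval: "real_polynomial_function (monom_eval \<alpha>)"
  unfolding monom_eval_def [abs_def]
  by (intro real_polynomial_function_prod real_polynomial_function_power
      real_polynomial_function_component) auto

lemma real_polynomial_function_poly_eval: "real_polynomial_function (poly_eval p)"
  unfolding poly_eval_def [abs_def]
  by (intro real_polynomial_function_sum real_polynomial_function.intros(4)
      real_polynomial_function.intros(2) real_polynomial_function_monom_eval) auto

text \<open>Approximation is carried out with polynomial functions, whereas L_u acts on formal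
  polynomials; this leads back from the former to the latter.\<close>

lemma real_polynomial_function_imp_poly_eval:
  fixes p :: "real^'n::finite \<Rightarrow> real"
  assumes "real_polynomial_function p"
  obtains P where "p = poly_eval P"
proof -
  have "\<exists>P. p = poly_eval P"
    using assms
  proof induction
    case (linear f)
    interpret bounded_linear f by fact
    have "f = poly_eval (\<Sum>i\<in>UNIV. Poly_Mapping.single 0 (f (axis i 1)) * poly_var i)"
    proof
      fix x :: "real^'n"
      have "f x = f (\<Sum>i\<in>UNIV. (x $ i) *\<^sub>R axis i 1)"
        using basis_expansion[of x] by (simp add: scalar_mult_eq_scaleR)
      also have "\<dots> = (\<Sum>i\<in>UNIV. x $ i * f (axis i 1))"
        by (simp add: sum scaleR)
      finally show "f x = poly_eval (\<Sum>i\<in>UNIV. Poly_Mapping.single 0 (f (axis i 1)) * poly_var i) x"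
        by (simp add: poly_eval_sum poly_eval_mult mult.commute)
    qed
    thus ?case ..
  next
    case (const c)
    have "(\<lambda>x. c) = poly_eval (Poly_Mapping.single 0 c :: 'n rpoly)" by auto
    thus ?case ..
  next
    case (add f h)
    then obtain P Q where "f = poly_eval P" "h = poly_eval Q" by auto
    hence "(\<lambda>x. f x + h x) = poly_eval (P + Q)" by (auto simp: poly_eval_add)
    thus ?case ..
  next
    case (mult f h)
    then obtain P Q where "f = poly_eval P" "h = poly_eval Q" by auto
    hence "(\<lambda>x. f x * h x) = poly_eval (P * Q)" by (auto simp: poly_eval_mult)
    thus ?case ..
  qed
  thus ?thesis using that by blast
qed

section \<open>Measures with exponentially decaying density\<close>

lemma borel_measurable_real_polynomial_function:
  "real_polynomial_function (p :: 'a::euclidean_space \<Rightarrow> real) \<Longrightarrow> p \<in> borel_measurable borel"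
  by (intro borel_measurable_continuous_onI continuous_on_polymonial_function)
     (simp add: real_polynomial_function_eq)

text \<open>A comparison function on the whole space: Tonelli splits its integral into a product of
  finite one-dimensional integrals.\<close>

lemma integrable_prod_inverse_1_plus_square:
  "integrable lborel (\<lambda>x::real^'n::finite. \<Prod>i\<in>UNIV. inverse (1 + (x $ i)\<^sup>2))"
proof (rule integrableI_nonneg)
  let ?h = "\<lambda>t::real. inverse (1 + t\<^sup>2)"
  show "(\<lambda>x::real^'n. \<Prod>i\<in>UNIV. ?h (x $ i)) \<in> borel_measurable lborel"
    by measurable
  have "integrable lborel ?h"
    using integrable_inverse_1_plus_square by (simp add: set_integrable_def)
  hence fin: "(\<integral>\<^sup>+t. ennreal (?h t) \<partial>lborel) < \<infinity>"
    by (simp add: integrable_iff_bounded)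
  \<comment> \<open>The product formula for \<open>lborel\<close> runs over \<open>Basis\<close>, so
    the coordinates are reindexed by the unit vectors.\<close>
  have "(\<Prod>i\<in>UNIV. ?h (x $ i)) = (\<Prod>b\<in>Basis. ?h (x \<bullet> b))" for x :: "real^'n"
  proof -
    have B: "(Basis :: (real^'n) set) = (\<lambda>i. axis i 1) ` UNIV"
      by (auto simp: Basis_vec_def)
    have "inj (\<lambda>i::'n. axis i (1::real))"
      by (auto intro!: injI simp: axis_eq_axis)
    thus ?thesis
      by (simp add: B prod.reindex inner_axis)
  qed
  hence "(\<integral>\<^sup>+x. ennreal (\<Prod>i\<in>UNIV. ?h ((x::real^'n) $ i)) \<partial>lborel)
      = (\<integral>\<^sup>+x. (\<Prod>b\<in>Basis. ennreal (?h ((x::real^'n) \<bullet> b))) \<partial>lborel)"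
    by (intro nn_integral_cong) (simp add: prod_ennreal)
  also have "\<dots> = (\<Prod>b\<in>(Basis :: (real^'n) set). (\<integral>\<^sup>+t. ennreal (?h t) \<partial>lborel))"
    by (rule nn_integral_lborel_prod) auto
  also have "\<dots> < \<infinity>"
    using fin by (simp add: power_less_top_ennreal)
  finally show "(\<integral>\<^sup>+x. ennreal (\<Prod>i\<in>UNIV. ?h ((x::real^'n) $ i)) \<partial>lborel) < \<infinity>" .
qed (auto intro!: prod_nonneg)

text \<open>A common frame for both measures: \<open>r\<close> is |x|^2 on the whole space, or the
  sum of the coordinates on the orthant. The bound on coordinates makes \<open>r\<close> dominate
  every linear form on \<open>S\<close>.\<close>

locale growth_polynomial =
  fixes r :: "real^'n::finite \<Rightarrow> real" and S :: "(real^'n) set"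
  assumes poly_r: "real_polynomial_function r"
    and r_nonneg: "\<And>x. x \<in> S \<Longrightarrow> 0 \<le> r x"
    and component_le: "\<And>x i. x \<in> S \<Longrightarrow> \<bar>x $ i\<bar> \<le> 1 + r x"
begin

text \<open>Induction on the polynomial, with \<delta> left arbitrary so that each factor of a
  product can be bounded with \<delta> / 2. For linear forms, 1 + \<delta> r \<le> exp (\<delta> r)
  suffices.\<close>

lemma polynomial_le_exp:
  assumes "real_polynomial_function p" "0 < \<delta>"
  obtains C where "0 \<le> C" "\<And>x. x \<in> S \<Longrightarrow> \<bar>p x\<bar> \<le> C * exp (\<delta> * r x)"
proof -
  have "\<exists>C\<ge>0. \<forall>x\<in>S. \<bar>p x\<bar> \<le> C * exp (\<delta> * r x)"
    using assms
  proof (induction arbitrary: \<delta>)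
    case (linear f)
    then obtain K where K: "0 \<le> K" "\<And>x. norm (f x) \<le> norm x * K"
      using bounded_linear.nonneg_bounded by blast
    have "\<bar>f x\<bar> \<le> (K * CARD('n) * (1 + 1 / \<delta>)) * exp (\<delta> * r x)" if "x \<in> S" for x
    proof -
      have "norm x \<le> (\<Sum>i\<in>UNIV. \<bar>x $ i\<bar>)" by (rule norm_le_l1_cart)
      also have "\<dots> \<le> (\<Sum>i\<in>(UNIV :: 'n set). 1 + r x)"
        using that by (intro sum_mono component_le)
      finally have n: "norm x \<le> CARD('n) * (1 + r x)" by simp
      have "1 + r x \<le> (1 + 1 / \<delta>) * (1 + \<delta> * r x)"
        using r_nonneg[OF that] linear by (simp add: field_simps)
      also have "\<dots> \<le> (1 + 1 / \<delta>) * exp (\<delta> * r x)"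
        using linear exp_ge_add_one_self by (intro mult_left_mono) auto
      finally have e: "1 + r x \<le> (1 + 1 / \<delta>) * exp (\<delta> * r x)" .
      have "\<bar>f x\<bar> \<le> K * norm x" using K(2)[of x] by (simp add: mult.commute)
      also have "\<dots> \<le> K * (CARD('n) * ((1 + 1 / \<delta>) * exp (\<delta> * r x)))"
        using n e K(1) by (intro mult_left_mono order.trans[OF n]) auto
      finally show ?thesis by (simp add: mult_ac)
    qed
    thus ?case using K linear by (intro exI[of _ "K * CARD('n) * (1 + 1 / \<delta>)"]) auto
  next
    case (const c)
    have "\<bar>c\<bar> * 1 \<le> \<bar>c\<bar> * exp (\<delta> * r x)" if "x \<in> S" for x
      using r_nonneg[OF that] const by (intro mult_left_mono) auto
    thus ?case by (intro exI[of _ "\<bar>c\<bar>"]) auto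
  next
    case (add f h)
    from add.IH(1)[OF add.prems] add.IH(2)[OF add.prems] obtain C D
      where CD: "C \<ge> 0" "\<forall>x\<in>S. \<bar>f x\<bar> \<le> C * exp (\<delta> * r x)"
        "D \<ge> 0" "\<forall>x\<in>S. \<bar>h x\<bar> \<le> D * exp (\<delta> * r x)" by blast
    have "\<forall>x\<in>S. \<bar>f x + h x\<bar> \<le> (C + D) * exp (\<delta> * r x)"
      using CD by (fastforce simp: distrib_right)
    thus ?case using CD by (intro exI[of _ "C + D"]) auto
  next
    case (mult f h)
    have \<delta>: "0 < \<delta> / 2" using mult.prems by simp
    from mult.IH(1)[OF \<delta>] mult.IH(2)[OF \<delta>] obtain C D
      where CD: "C \<ge> 0" "\<forall>x\<in>S. \<bar>f x\<bar> \<le> C * exp (\<delta> / 2 * r x)"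
        "D \<ge> 0" "\<forall>x\<in>S. \<bar>h x\<bar> \<le> D * exp (\<delta> / 2 * r x)" by blast
    have "\<bar>f x * h x\<bar> \<le> (C * D) * exp (\<delta> * r x)" if "x \<in> S" for x
    proof -
      have "\<bar>f x * h x\<bar> \<le> (C * exp (\<delta> / 2 * r x)) * (D * exp (\<delta> / 2 * r x))"
        unfolding abs_mult using CD that by (intro mult_mono) auto
      also have "\<dots> = (C * D) * (exp (\<delta> / 2 * r x) * exp (\<delta> / 2 * r x))" by simp
      also have "\<dots> = (C * D) * exp (\<delta> * r x)"
        unfolding exp_add[symmetric] by simp
      finally show ?thesis .
    qed
    thus ?case using CD by (intro exI[of _ "C * D"]) auto
  qed
  thus ?thesis using that by blast
qed

end

locale decaying_measure = growth_polynomial r S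
  for r :: "real^'n::finite \<Rightarrow> real" and S :: "(real^'n) set" +
  fixes \<mu> :: "(real^'n) measure" and k \<kappa> :: real
  assumes measure_eq: "\<mu> = density lborel (\<lambda>x. ennreal (k * exp (- \<kappa> * r x) * indicator S x))"
    and k_nonneg: "0 \<le> k" and decay_pos: "0 < \<kappa>" and borel_S: "S \<in> sets borel"
begin

lemma sets_measure [simp, measurable_cong]: "sets \<mu> = sets borel"
  by (simp add: measure_eq)

lemma space_measure [simp]: "space \<mu> = UNIV"
  by (simp add: measure_eq)

lemma borel_measurable_r [measurable]: "r \<in> borel_measurable borel"
  using poly_r by (rule borel_measurable_real_polynomial_function)

lemma density_measurable:
  "(\<lambda>x. k * exp (- \<kappa> * r x) * indicator S x) \<in> borel_measurable borel"
  using borel_S by measurable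

lemma AE_in_S: "AE x in \<mu>. x \<in> S"
  unfolding measure_eq by (subst AE_density) (use density_measurable in \<open>auto simp: indicator_def\<close>)

text \<open>The remaining decay \<kappa> - c > 0 absorbs \<open>p\<close> times the product of the 1
  + x_i^2. Against Lebesgue measure the integrand is therefore at most a constant times the inverse
  of that product.\<close>

lemma integrable_polynomial_exp:
  assumes p: "real_polynomial_function p" and c: "c < \<kappa>"
  shows "integrable \<mu> (\<lambda>x. p x * exp (c * r x))"
proof -
  note [measurable] = borel_measurable_real_polynomial_function[OF p] borel_S density_measurable
  let ?w = "\<lambda>x::real^'n. \<Prod>i\<in>UNIV. 1 + (x $ i)\<^sup>2"
  let ?h = "\<lambda>x. k * exp (- \<kappa> * r x) * indicator S x"
  have "real_polynomial_function (\<lambda>x. p x * ?w x)"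
    by (intro p real_polynomial_function.intros(2-4) real_polynomial_function_prod
        real_polynomial_function_power real_polynomial_function_component) auto
  then obtain C where C: "0 \<le> C" "\<And>x. x \<in> S \<Longrightarrow> \<bar>p x * ?w x\<bar> \<le> C * exp ((\<kappa> - c) * r x)"
    using polynomial_le_exp[of "\<lambda>x. p x * ?w x" "\<kappa> - c"] c by auto
  have "integrable lborel (\<lambda>x. (k * C) * (\<Prod>i\<in>UNIV. inverse (1 + (x $ i)\<^sup>2)))"
    by (intro integrable_mult_right integrable_prod_inverse_1_plus_square)
  hence "integrable lborel (\<lambda>x. ?h x *\<^sub>R (p x * exp (c * r x)))"
  proof (rule Bochner_Integration.integrable_bound)
    show "AE x in lborel. norm (?h x *\<^sub>R (p x * exp (c * r x)))
        \<le> norm ((k * C) * (\<Prod>i\<in>UNIV. inverse (1 + (x $ i)\<^sup>2)))"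
    proof (intro AE_I2)
      fix x :: "real^'n"
      have w: "?w x > 0" by (intro prod_pos) (auto simp: add_pos_nonneg)
      have i: "(\<Prod>i\<in>UNIV. inverse (1 + (x $ i)\<^sup>2)) = inverse (?w x)"
        by (simp add: prod_inversef[symmetric] o_def)
      show "norm (?h x *\<^sub>R (p x * exp (c * r x)))
        \<le> norm ((k * C) * (\<Prod>i\<in>UNIV. inverse (1 + (x $ i)\<^sup>2)))"
      proof (cases "x \<in> S")
        case True
        have "norm (?h x *\<^sub>R (p x * exp (c * r x))) = k * (\<bar>p x\<bar> * exp (- ((\<kappa> - c) * r x)))"
        proof -
          have "exp (- \<kappa> * r x) * exp (c * r x) = exp (- ((\<kappa> - c) * r x))"
            by (simp add: algebra_simps flip: exp_add)
          thus ?thesis using True k_nonneg by (simp add: abs_mult mult_ac)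
        qed
        also have "\<dots> = k * ((\<bar>p x * ?w x\<bar> * exp (- ((\<kappa> - c) * r x))) * inverse (?w x))"
          using w by (simp add: abs_mult less_imp_neq[OF w, symmetric] del: prod_zero_iff prod_pos)
        also have "\<dots> \<le> k * ((C * exp ((\<kappa> - c) * r x) * exp (- ((\<kappa> - c) * r x))) * inverse (?w x))"
          using C(2)[OF True] k_nonneg w by (intro mult_left_mono mult_right_mono) auto
        also have "\<dots> = k * C * inverse (?w x)"
          by (simp add: mult.assoc flip: exp_add)
        also have "\<dots> = norm ((k * C) * (\<Prod>i\<in>UNIV. inverse (1 + (x $ i)\<^sup>2)))"
          unfolding i using w k_nonneg C by (simp add: abs_mult)
        finally show ?thesis .
      qed auto
    qed
  qed measurable
  thus ?thesis
    unfolding measure_eq using k_nonneg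
    by (subst integrable_density) (auto intro!: AE_I2)
qed

end

section \<open>Density of the polynomials\<close>

lemma power4_add_le: "(a + b) ^ 4 \<le> 8 * a ^ 4 + 8 * (b::real) ^ 4"
proof -
  have "(a + b)\<^sup>2 \<le> 2 * (a\<^sup>2 + b\<^sup>2)"
    using sum_squares_ge_zero[of "a - b" 0] by (simp add: power2_eq_square algebra_simps)
  hence "((a + b)\<^sup>2)\<^sup>2 \<le> (2 * (a\<^sup>2 + b\<^sup>2))\<^sup>2"
    by (intro power_mono) auto
  also have "\<dots> \<le> 8 * ((a\<^sup>2)\<^sup>2 + (b\<^sup>2)\<^sup>2)"
    using sum_squares_ge_zero[of "a\<^sup>2 - b\<^sup>2" 0] by (simp add: power2_eq_square algebra_simps)
  finally show ?thesis by (simp flip: power_mult)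
qed

lemma power4_le_of_abs_le: "\<bar>a\<bar> \<le> b \<Longrightarrow> a ^ 4 \<le> (b::real) ^ 4"
  using power_mono[of "\<bar>a\<bar>" b 4] by simp

text \<open>Stands in for the triangle inequality of a norm: the factor 8 is that of
  \<open>power4_add_le\<close>, and 8 e / 16 + 8 e / 16 = e.\<close>

lemma ennreal_less_of_split:
  assumes "0 < e" "x < ennreal (e / 16)" "y < ennreal (e / 16)" "z \<le> 8 * x + 8 * y"
  shows "z < ennreal e"
proof -
  obtain a where a: "0 \<le> a" "x = ennreal a" "a < e / 16"
    using assms by (cases x) (auto simp: ennreal_less_iff)
  obtain b where b: "0 \<le> b" "y = ennreal b" "b < e / 16"
    using assms by (cases y) (auto simp: ennreal_less_iff)
  have "8 * x + 8 * y = ennreal (8 * a + 8 * b)"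
    using a b by (simp add: ennreal_mult)
  also have "\<dots> < ennreal e" using a b assms by (intro ennreal_lessI) auto
  finally show ?thesis using assms by simp
qed

text \<open>A bound independent of \<open>N\<close>, so that it can dominate the Taylor polynomials
  of exp (- t r) when passing to the limit.\<close>

lemma abs_exp_partial_sum_le:
  fixes z :: real
  shows "\<bar>\<Sum>k<N. (- z) ^ k / fact k\<bar> \<le> exp \<bar>z\<bar>"
proof -
  have "\<bar>\<Sum>k<N. (- z) ^ k / fact k\<bar> \<le> (\<Sum>k<N. \<bar>z\<bar> ^ k / fact k)"
    by (rule order.trans[OF sum_abs]) (simp add: power_abs)
  also have "\<dots> \<le> suminf (\<lambda>k. \<bar>z\<bar> ^ k / fact k)"
    using summable_exp[of "\<bar>z\<bar>"] by (intro sum_le_suminf) (auto simp: field_simps)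
  also have "\<dots> = exp \<bar>z\<bar>" by (simp add: exp_def field_simps)
  finally show ?thesis .
qed

text \<open>Applied later with \<rho> = \<gamma>^2 \<mu> for a polynomial \<gamma> and with c =
  \<kappa> / 2.\<close>

locale exponential_moments = growth_polynomial r S
  for r :: "real^'n::finite \<Rightarrow> real" and S :: "(real^'n) set" +
  fixes \<rho> :: "(real^'n) measure" and c :: real
  assumes sets_rho [simp, measurable_cong]: "sets \<rho> = sets borel"
    and c_pos: "0 < c"
    and AE_S: "AE x in \<rho>. x \<in> S"
    and integrable_exp: "\<And>p. real_polynomial_function p \<Longrightarrow> integrable \<rho> (\<lambda>x. p x * exp (c * r x))"
begin

lemma space_rho [simp]: "space \<rho> = UNIV"
  using sets_eq_imp_space_eq[OF sets_rho] by simp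

lemma measurable_rho [simp]: "measurable \<rho> borel = measurable borel borel"
  by (intro measurable_cong_sets) auto

text \<open>The fourth power of the \<open>L\<^sup>4\<close> distance, so that no roots are taken.\<close>

definition dist4 :: "(real^'n \<Rightarrow> real) \<Rightarrow> (real^'n \<Rightarrow> real) \<Rightarrow> ennreal" where
  "dist4 v w = (\<integral>\<^sup>+x. ennreal ((v x - w x) ^ 4) \<partial>\<rho>)"

text \<open>The space V. Polynomials have finite fourth moments here, so closeness to one of them
  already puts \<open>v\<close> into L^4(\<rho>).\<close>

definition approximable :: "(real^'n \<Rightarrow> real) \<Rightarrow> bool" where
  "approximable v \<longleftrightarrow> v \<in> borel_measurable borel \<and>
     (\<forall>e>0. \<exists>p. real_polynomial_function p \<and> dist4 v p < ennreal e)"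

text \<open>The bound is asked for almost everywhere only, because functions such as q exp (- t r)
  are controlled only on \<open>S\<close>.\<close>

definition multiplier :: "(real^'n \<Rightarrow> real) \<Rightarrow> bool" where
  "multiplier f \<longleftrightarrow> f \<in> borel_measurable borel \<and> (\<exists>B\<ge>0. AE x in \<rho>. \<bar>f x\<bar> \<le> B) \<and>
     (\<forall>v. approximable v \<longrightarrow> approximable (\<lambda>x. f x * v x))"

lemma approximable_measurable: "approximable v \<Longrightarrow> v \<in> borel_measurable borel"
  by (simp add: approximable_def)

lemma multiplier_measurable: "multiplier f \<Longrightarrow> f \<in> borel_measurable borel"
  by (simp add: multiplier_def)

lemma multiplierE:
  assumes "multiplier f"
  obtains B where "0 \<le> B" "AE x in \<rho>. \<bar>f x\<bar> \<le> B"
  using assms unfolding multiplier_def by blast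

section \<open>The closure V of the polynomials\<close>

lemma dist4_triangle:
  assumes [measurable]: "u \<in> borel_measurable borel" "v \<in> borel_measurable borel" "w \<in> borel_measurable borel"
  shows "dist4 u w \<le> 8 * dist4 u v + 8 * dist4 v w"
proof -
  have "dist4 u w \<le> (\<integral>\<^sup>+x. 8 * ennreal ((u x - v x) ^ 4) + 8 * ennreal ((v x - w x) ^ 4) \<partial>\<rho>)"
    unfolding dist4_def
  proof (intro nn_integral_mono)
    fix x
    have "ennreal ((u x - w x) ^ 4) \<le> ennreal (8 * (u x - v x) ^ 4 + 8 * (v x - w x) ^ 4)"
      using power4_add_le[of "u x - v x" "v x - w x"] by (intro ennreal_leI) simp
    thus "ennreal ((u x - w x) ^ 4) \<le> 8 * ennreal ((u x - v x) ^ 4) + 8 * ennreal ((v x - w x) ^ 4)"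
      by (simp add: ennreal_mult)
  qed
  also have "\<dots> = 8 * dist4 u v + 8 * dist4 v w"
    unfolding dist4_def by (subst nn_integral_add) (auto simp: nn_integral_cmult)
  finally show ?thesis .
qed

lemma approximable_polynomial: "real_polynomial_function p \<Longrightarrow> approximable p"
  unfolding approximable_def
  by (auto simp: dist4_def borel_measurable_real_polynomial_function intro!: exI[of _ p])

lemma approximable_closure:
  assumes v: "v \<in> borel_measurable borel"
    and *: "\<And>e. 0 < e \<Longrightarrow> \<exists>w. approximable w \<and> dist4 v w < ennreal e"
  shows "approximable v"
  unfolding approximable_def
proof (intro conjI allI impI)
  fix e :: real assume e: "0 < e"
  obtain w where w: "approximable w" "dist4 v w < ennreal (e / 16)"
    using *[of "e / 16"] e by auto
  then obtain p where p: "real_polynomial_function p" "dist4 w p < ennreal (e / 16)"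
    using e unfolding approximable_def by (meson divide_pos_pos zero_less_numeral)
  have "dist4 v p < ennreal e"
    by (rule ennreal_less_of_split[OF e w(2) p(2)], rule dist4_triangle)
       (use v w p in \<open>auto simp: approximable_measurable borel_measurable_real_polynomial_function\<close>)
  thus "\<exists>p. real_polynomial_function p \<and> dist4 v p < ennreal e" using p by blast
qed (fact v)

text \<open>The main source of new members of V: by dominated convergence for the fourth powers of
  the differences, \<open>dist4 v (w n)\<close> tends to 0.\<close>

lemma approximable_dominated_limit:
  assumes v: "v \<in> borel_measurable borel" and w: "\<And>n. approximable (w n)"
    and lim: "AE x in \<rho>. (\<lambda>n. w n x) \<longlonglongrightarrow> v x"
    and F: "F \<in> borel_measurable borel" "(\<integral>\<^sup>+x. ennreal (F x) \<partial>\<rho>) < \<infinity>"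
    and bound: "\<And>n. AE x in \<rho>. (v x - w n x) ^ 4 \<le> F x"
  shows "approximable v"
proof (rule approximable_closure[OF v])
  fix e :: real assume e: "0 < e"
  note [measurable] = v F(1) approximable_measurable[OF w]
  have "(\<lambda>n. dist4 v (w n)) \<longlonglongrightarrow> (\<integral>\<^sup>+x. 0 \<partial>\<rho>)"
    unfolding dist4_def
  proof (rule nn_integral_dominated_convergence[where w = "\<lambda>x. ennreal (F x)"])
    show "AE x in \<rho>. ennreal ((v x - w n x) ^ 4) \<le> ennreal (F x)" for n
      using bound[of n] by eventually_elim (rule ennreal_leI)
    show "AE x in \<rho>. (\<lambda>n. ennreal ((v x - w n x) ^ 4)) \<longlonglongrightarrow> 0"
      using lim
    proof eventually_elim
      case (elim x)
      have "(\<lambda>n. ennreal ((v x - w n x) ^ 4)) \<longlonglongrightarrow> ennreal ((v x - v x) ^ 4)"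
        by (intro tendsto_intros elim)
      thus ?case by simp
    qed
  qed (use F in auto)
  hence "\<forall>\<^sub>F n in sequentially. dist4 v (w n) < ennreal e"
    using e by (intro order_tendstoD) auto
  thus "\<exists>w. approximable w \<and> dist4 v w < ennreal e"
    using w by (metis eventually_happens trivial_limit_sequentially)
qed

lemma approximable_add:
  assumes u: "approximable u" and v: "approximable v"
  shows "approximable (\<lambda>x. u x + v x)"
  unfolding approximable_def
proof (intro conjI allI impI)
  note [measurable] = approximable_measurable[OF u] approximable_measurable[OF v]
  show "(\<lambda>x. u x + v x) \<in> borel_measurable borel" by measurable
  fix e :: real assume e: "0 < e"
  hence e': "0 < e / 16" by simp
  obtain p where p: "real_polynomial_function p" "dist4 u p < ennreal (e / 16)"
    using u e' unfolding approximable_def by blast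
  obtain q where q: "real_polynomial_function q" "dist4 v q < ennreal (e / 16)"
    using v e' unfolding approximable_def by blast
  note [measurable] = p(1)[THEN borel_measurable_real_polynomial_function]
    q(1)[THEN borel_measurable_real_polynomial_function]
  have "dist4 (\<lambda>x. u x + v x) (\<lambda>x. p x + q x)
      \<le> 8 * dist4 (\<lambda>x. u x + v x) (\<lambda>x. p x + v x) + 8 * dist4 (\<lambda>x. p x + v x) (\<lambda>x. p x + q x)"
    by (rule dist4_triangle) measurable
  also have "dist4 (\<lambda>x. u x + v x) (\<lambda>x. p x + v x) = dist4 u p" by (simp add: dist4_def)
  also have "dist4 (\<lambda>x. p x + v x) (\<lambda>x. p x + q x) = dist4 v q" by (simp add: dist4_def)
  finally have "dist4 (\<lambda>x. u x + v x) (\<lambda>x. p x + q x) < ennreal e"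
    by (rule ennreal_less_of_split[OF e p(2) q(2)])
  thus "\<exists>p. real_polynomial_function p \<and> dist4 (\<lambda>x. u x + v x) p < ennreal e"
    using real_polynomial_function.intros(3)[OF p(1) q(1)] by blast
qed

section \<open>The algebra of multipliers\<close>

lemma dist4_mult_le:
  assumes [measurable]: "v \<in> borel_measurable borel" "w \<in> borel_measurable borel"
    and B: "AE x in \<rho>. \<bar>f x\<bar> \<le> B"
  shows "dist4 (\<lambda>x. f x * v x) (\<lambda>x. f x * w x) \<le> ennreal (B ^ 4) * dist4 v w"
proof -
  have "dist4 (\<lambda>x. f x * v x) (\<lambda>x. f x * w x) \<le> (\<integral>\<^sup>+x. ennreal (B ^ 4) * ennreal ((v x - w x) ^ 4) \<partial>\<rho>)"
    unfolding dist4_def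
  proof (rule nn_integral_mono_AE, use B in eventually_elim)
    case (elim x)
    have "(f x * v x - f x * w x) ^ 4 = f x ^ 4 * (v x - w x) ^ 4"
      by (simp add: right_diff_distrib power_mult_distrib flip: right_diff_distrib)
    also have "\<dots> \<le> B ^ 4 * (v x - w x) ^ 4"
      using power4_le_of_abs_le[OF elim] by (intro mult_right_mono) auto
    finally show ?case by (subst ennreal_mult[symmetric]) (auto intro!: ennreal_leI)
  qed
  also have "\<dots> = ennreal (B ^ 4) * dist4 v w"
    unfolding dist4_def by (intro nn_integral_cmult) measurable
  finally show ?thesis .
qed

text \<open>Multiplication by a bounded \<open>f\<close> is continuous for \<open>dist4\<close> and
  V is closed, so it is enough to test \<open>f\<close> on the dense set of polynomials.\<close>

lemma multiplierI:
  assumes f: "f \<in> borel_measurable borel" and B: "0 \<le> B" "AE x in \<rho>. \<bar>f x\<bar> \<le> B"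
    and p: "\<And>p. real_polynomial_function p \<Longrightarrow> approximable (\<lambda>x. f x * p x)"
  shows "multiplier f"
  unfolding multiplier_def
proof (intro conjI allI impI)
  fix v assume v: "approximable v"
  note [measurable] = f approximable_measurable[OF v]
  show "approximable (\<lambda>x. f x * v x)"
  proof (rule approximable_closure)
    fix e :: real assume e: "0 < e"
    \<comment> \<open>The \<open>+ 1\<close> covers the case B = 0.\<close>
    hence "0 < e / (B ^ 4 + 1)" using B by (simp add: add_nonneg_pos)
    then obtain q where q: "real_polynomial_function q" "dist4 v q < ennreal (e / (B ^ 4 + 1))"
      using v unfolding approximable_def by meson
    note [measurable] = q(1)[THEN borel_measurable_real_polynomial_function]
    obtain a where a: "0 \<le> a" "dist4 v q = ennreal a" "a < e / (B ^ 4 + 1)"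
      using q(2) by (cases "dist4 v q") (auto simp: ennreal_less_iff)
    have "a * B ^ 4 \<le> a * (B ^ 4 + 1)" using a by (intro mult_left_mono) auto
    also have "\<dots> < e"
      using a(3) B by (simp add: pos_less_divide_eq add_nonneg_pos)
    finally have aB: "B ^ 4 * a < e" by (simp add: mult.commute)
    have "dist4 (\<lambda>x. f x * v x) (\<lambda>x. f x * q x) \<le> ennreal (B ^ 4) * dist4 v q"
      by (rule dist4_mult_le[OF _ _ B(2)]) measurable
    also have "\<dots> = ennreal (B ^ 4 * a)" using a B by (simp add: ennreal_mult)
    also have "\<dots> < ennreal e" using aB e by (intro ennreal_lessI)
    finally show "\<exists>w. approximable w \<and> dist4 (\<lambda>x. f x * v x) w < ennreal e"
      using p[OF q(1)] by blast
  qed measurable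
qed (use f B in blast)+

lemma nn_integral_polynomial_exp_finite:
  assumes p: "real_polynomial_function p" and K: "0 \<le> K"
  shows "(\<integral>\<^sup>+x. ennreal (K * (p x ^ 4 * exp (c * r x))) \<partial>\<rho>) < \<infinity>"
proof -
  have "integrable \<rho> (\<lambda>x. K * (p x ^ 4 * exp (c * r x)))"
    by (intro integrable_mult_right integrable_exp real_polynomial_function_power p)
  hence "(\<integral>\<^sup>+x. ennreal (norm (K * (p x ^ 4 * exp (c * r x)))) \<partial>\<rho>) < \<infinity>"
    unfolding integrable_iff_bounded by blast
  thus ?thesis using K by (simp add: abs_mult)
qed

lemma nn_integral_polynomial_finite:
  assumes p: "real_polynomial_function p" and K: "0 \<le> K"
  shows "(\<integral>\<^sup>+x. ennreal (K * p x ^ 4) \<partial>\<rho>) < \<infinity>"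
proof (rule le_less_trans[OF nn_integral_mono_AE nn_integral_polynomial_exp_finite[OF p K]])
  show "AE x in \<rho>. ennreal (K * p x ^ 4) \<le> ennreal (K * (p x ^ 4 * exp (c * r x)))"
    using AE_S
  proof eventually_elim
    case (elim x)
    have "p x ^ 4 * 1 \<le> p x ^ 4 * exp (c * r x)"
      using r_nonneg[OF elim] c_pos by (intro mult_left_mono) auto
    thus ?case using K by (intro ennreal_leI mult_left_mono) auto
  qed
qed

text \<open>Tested on a polynomial \<open>p\<close>, the fourth powers of the differences are
  dominated by (2 B)^4 p^4, which is integrable.\<close>

lemma multiplier_bounded_limit:
  assumes f: "f \<in> borel_measurable borel" and w: "\<And>n. multiplier (w n)"
    and lim: "AE x in \<rho>. (\<lambda>n. w n x) \<longlonglongrightarrow> f x"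
    and B: "0 \<le> B" "\<And>n. AE x in \<rho>. \<bar>w n x\<bar> \<le> B" "AE x in \<rho>. \<bar>f x\<bar> \<le> B"
  shows "multiplier f"
proof (rule multiplierI[OF f B(1,3)])
  fix p :: "real^'n \<Rightarrow> real" assume p: "real_polynomial_function p"
  note [measurable] = f borel_measurable_real_polynomial_function[OF p]
  show "approximable (\<lambda>x. f x * p x)"
  proof (rule approximable_dominated_limit[where w = "\<lambda>n x. w n x * p x" and F = "\<lambda>x. (2 * B) ^ 4 * p x ^ 4"])
    show "approximable (\<lambda>x. w n x * p x)" for n
      using w approximable_polynomial[OF p] by (auto simp: multiplier_def)
    show "AE x in \<rho>. (\<lambda>n. w n x * p x) \<longlonglongrightarrow> f x * p x"
      using lim by eventually_elim (intro tendsto_intros)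
    show "(\<integral>\<^sup>+x. ennreal ((2 * B) ^ 4 * p x ^ 4) \<partial>\<rho>) < \<infinity>"
      by (intro nn_integral_polynomial_finite p) auto
    show "AE x in \<rho>. (f x * p x - w n x * p x) ^ 4 \<le> (2 * B) ^ 4 * p x ^ 4" for n
      using B(2)[of n] B(3)
    proof eventually_elim
      case (elim x)
      have "(f x - w n x) ^ 4 \<le> (2 * B) ^ 4"
        using elim by (intro power4_le_of_abs_le) linarith
      thus ?case
        by (simp add: power_mult_distrib mult_right_mono flip: left_diff_distrib)
    qed
  qed measurable
qed

lemma multiplier_const: "multiplier (\<lambda>x. a)"
  by (rule multiplierI[of _ "\<bar>a\<bar>"]) (auto intro!: approximable_polynomial)

lemma multiplier_add:
  assumes "multiplier f" "multiplier h"
  shows "multiplier (\<lambda>x. f x + h x)"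
proof -
  obtain B where B: "0 \<le> B" "AE x in \<rho>. \<bar>f x\<bar> \<le> B" using assms(1) by (rule multiplierE)
  obtain D where D: "0 \<le> D" "AE x in \<rho>. \<bar>h x\<bar> \<le> D" using assms(2) by (rule multiplierE)
  note [measurable] = assms[THEN multiplier_measurable]
  show ?thesis
  proof (rule multiplierI[of _ "B + D"])
    show "AE x in \<rho>. \<bar>f x + h x\<bar> \<le> B + D" using B(2) D(2) by eventually_elim linarith
    fix p :: "real^'n \<Rightarrow> real" assume "real_polynomial_function p"
    hence "approximable p" by (rule approximable_polynomial)
    thus "approximable (\<lambda>x. (f x + h x) * p x)"
      using assms unfolding multiplier_def distrib_right by (intro approximable_add) auto
  qed (use B D in auto)
qed

lemma multiplier_mult:
  assumes "multiplier f" "multiplier h"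
  shows "multiplier (\<lambda>x. f x * h x)"
proof -
  obtain B where B: "0 \<le> B" "AE x in \<rho>. \<bar>f x\<bar> \<le> B" using assms(1) by (rule multiplierE)
  obtain D where D: "0 \<le> D" "AE x in \<rho>. \<bar>h x\<bar> \<le> D" using assms(2) by (rule multiplierE)
  note [measurable] = assms[THEN multiplier_measurable]
  show ?thesis
  proof (rule multiplierI[of _ "B * D"])
    show "AE x in \<rho>. \<bar>f x * h x\<bar> \<le> B * D"
      using B(2) D(2) by eventually_elim (auto simp: abs_mult intro!: mult_mono B)
    fix p :: "real^'n \<Rightarrow> real" assume "real_polynomial_function p"
    hence "approximable p" by (rule approximable_polynomial)
    thus "approximable (\<lambda>x. (f x * h x) * p x)"
      using assms unfolding multiplier_def mult.assoc by auto
  qed (use B D in auto)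
qed

lemma multiplier_diff:
  assumes "multiplier f" "multiplier h"
  shows "multiplier (\<lambda>x. f x - h x)"
  using multiplier_add[OF assms(1) multiplier_mult[OF multiplier_const[of "-1"] assms(2)]] by simp

lemma multiplier_prod:
  "(\<And>i. i \<in> I \<Longrightarrow> multiplier (f i)) \<Longrightarrow> multiplier (\<lambda>x. \<Prod>i\<in>I. f i x)"
  by (induction I rule: infinite_finite_induct) (auto simp: multiplier_const intro: multiplier_mult)

section \<open>Indicators of Borel sets as multipliers\<close>

lemma multiplier_polynomial_compose:
  fixes F :: "real \<Rightarrow> real"
  assumes F: "real_polynomial_function F" and f: "multiplier f"
  shows "multiplier (\<lambda>x. F (f x))"
  using F
proof induction
  case (linear h)
  then obtain a where "h = (\<lambda>x. x * a)" using real_bounded_linear by blast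
  thus ?case using multiplier_mult[OF f multiplier_const[of a]] by simp
qed (auto intro: multiplier_const multiplier_add multiplier_mult)

text \<open>The indicator is a pointwise limit of continuous ramps in \<open>f\<close>. By
  Weierstrass on [-B, B] the ramps may be replaced by polynomials in \<open>f\<close>, which are
  multipliers.\<close>

lemma multiplier_indicator_pos:
  assumes f: "multiplier f"
  shows "multiplier (indicator {x. 0 < f x})"
proof -
  obtain B where B: "0 \<le> B" "AE x in \<rho>. \<bar>f x\<bar> \<le> B" using f by (rule multiplierE)
  \<comment> \<open>For n > 0 the ramp rises from 0 at y = 0 to 1 at y = 1/n.\<close>
  define s where "s n y = min 1 (max 0 (real n * y))" for n y
  have "\<exists>F. real_polynomial_function F \<and> (\<forall>y\<in>{-B..B}. \<bar>s n y - F y\<bar> < inverse (Suc n))" for n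
  proof -
    have "continuous_on {-B..B} (s n)" unfolding s_def by (intro continuous_intros)
    thus ?thesis
      using Stone_Weierstrass_real_polynomial_function[of "{-B..B}" "s n" "inverse (Suc n)"]
      by (metis compact_Icc inverse_positive_iff_positive of_nat_0_less_iff zero_less_Suc)
  qed
  then obtain F where F: "\<And>n. real_polynomial_function (F n)"
    "\<And>n y. y \<in> {-B..B} \<Longrightarrow> \<bar>s n y - F n y\<bar> < inverse (Suc n)" by metis
  note [measurable] = multiplier_measurable[OF f]
  show ?thesis
  \<comment> \<open>The bound 2 is 1 for the ramp plus at most 1 for the Weierstrass error.\<close>
  proof (rule multiplier_bounded_limit[where w = "\<lambda>n x. F n (f x)" and B = 2])
    show "multiplier (\<lambda>x. F n (f x))" for n by (rule multiplier_polynomial_compose[OF F(1) f])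
    show "AE x in \<rho>. \<bar>F n (f x)\<bar> \<le> 2" for n
      using B(2)
    proof eventually_elim
      case (elim x)
      have "\<bar>s n (f x) - F n (f x)\<bar> < inverse (Suc n)" using elim by (intro F(2)) auto
      also have "\<dots> \<le> 1" by (simp add: inverse_le_1_iff)
      finally show ?case by (auto simp: s_def split: if_splits)
    qed
    show "AE x in \<rho>. (\<lambda>n. F n (f x)) \<longlonglongrightarrow> indicator {x. 0 < f x} x"
      using B(2)
    proof eventually_elim
      case (elim x)
      have "(\<lambda>n. s n (f x) - F n (f x)) \<longlonglongrightarrow> 0"
      proof (rule tendsto_rabs_zero_cancel, rule tendsto_sandwich[OF _ _ tendsto_const LIMSEQ_inverse_real_of_nat])
        show "\<forall>\<^sub>F n in sequentially. \<bar>s n (f x) - F n (f x)\<bar> \<le> inverse (real (Suc n))"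
          using elim by (intro always_eventually allI less_imp_le F(2)) auto
      qed auto
      moreover have "(\<lambda>n. s n (f x)) \<longlonglongrightarrow> indicator {x. 0 < f x} x"
      proof (cases "0 < f x")
        case True
        obtain N where N: "1 < real N * f x" using True reals_Archimedean3 by blast
        have "\<forall>\<^sub>F n in sequentially. s n (f x) = 1"
        proof (rule eventually_sequentiallyI[of N])
          fix n assume "N \<le> n"
          hence "real N * f x \<le> real n * f x" using True by simp
          thus "s n (f x) = 1" using N by (simp add: s_def)
        qed
        thus ?thesis using True by (simp add: tendsto_eventually)
      next
        case False
        hence "real n * f x \<le> 0" for n by (intro mult_nonneg_nonpos) auto
        hence "s n (f x) = 0" for n by (simp add: s_def max_absorb1)
        thus ?thesis using False by simp
      qed
      ultimately have "(\<lambda>n. s n (f x) - (s n (f x) - F n (f x))) \<longlonglongrightarrow> indicator {x. 0 < f x} x - 0"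
        by (intro tendsto_diff)
      thus ?case by simp
    qed
  qed (auto simp: indicator_def)
qed

text \<open>The Taylor polynomials of exp (- t r) times \<open>p\<close> are polynomials and
  converge pointwise. With z = t r their error is at most 2 exp z in absolute value on
  \<open>S\<close>, and its fourth power involves exp (4 t r). The choice t = c / 4 turns this into
  the integrable exp (c r).\<close>

lemma approximable_exp_times:
  assumes p: "real_polynomial_function p"
  shows "approximable (\<lambda>x. exp (- (c / 4) * r x) * p x)"
proof -
  note [measurable] = borel_measurable_real_polynomial_function[OF p]
    borel_measurable_real_polynomial_function[OF poly_r]
  let ?z = "\<lambda>x. c / 4 * r x"
  let ?T = "\<lambda>N x. \<Sum>k<N. (- ?z x) ^ k / fact k"
  show ?thesis
  proof (rule approximable_dominated_limit[where w = "\<lambda>N x. ?T N x * p x"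
        and F = "\<lambda>x. 2 ^ 4 * (p x ^ 4 * exp (c * r x))"])
    show "approximable (\<lambda>x. ?T N x * p x)" for N
      by (intro approximable_polynomial real_polynomial_function.intros(4) p
          real_polynomial_function_sum real_polynomial_function_divide real_polynomial_function_power
          real_polynomial_function_minus real_polynomial_function.intros(2) poly_r) auto
    show "AE x in \<rho>. (\<lambda>N. ?T N x * p x) \<longlonglongrightarrow> exp (- (c / 4) * r x) * p x"
    proof (intro AE_I2 tendsto_mult tendsto_const)
      fix x
      have "(\<lambda>k. (- ?z x) ^ k / fact k) sums exp (- ?z x)"
        using exp_converges[of "- ?z x"] by (simp add: field_simps)
      thus "(\<lambda>N. ?T N x) \<longlonglongrightarrow> exp (- (c / 4) * r x)" by (simp add: sums_def)
    qed
    show "(\<integral>\<^sup>+x. ennreal (2 ^ 4 * (p x ^ 4 * exp (c * r x))) \<partial>\<rho>) < \<infinity>"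
      by (intro nn_integral_polynomial_exp_finite p) auto
    show "AE x in \<rho>. (exp (- (c / 4) * r x) * p x - ?T N x * p x) ^ 4 \<le> 2 ^ 4 * (p x ^ 4 * exp (c * r x))" for N
      using AE_S
    proof eventually_elim
      case (elim x)
      have z: "0 \<le> ?z x" using r_nonneg[OF elim] c_pos by simp
      have "\<bar>?T N x\<bar> \<le> exp (?z x)" using abs_exp_partial_sum_le[where z = "?z x" and N = N] z by simp
      moreover have "exp (- (c / 4) * r x) \<le> exp (?z x)" using z by simp
      ultimately have "\<bar>exp (- (c / 4) * r x) - ?T N x\<bar> \<le> 2 * exp (?z x)"
        using abs_triangle_ineq4[of "exp (- (c / 4) * r x)" "?T N x"] unfolding abs_exp_cancel by linarith
      hence "(exp (- (c / 4) * r x) - ?T N x) ^ 4 \<le> (2 * exp (?z x)) ^ 4"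
        by (rule power4_le_of_abs_le)
      also have "\<dots> = 2 ^ 4 * exp (c * r x)"
        by (simp add: power_mult_distrib flip: exp_of_nat_mult)
      finally have "(exp (- (c / 4) * r x) - ?T N x) ^ 4 * p x ^ 4 \<le> (2 ^ 4 * exp (c * r x)) * p x ^ 4"
        by (intro mult_right_mono) auto
      moreover have "(exp (- (c / 4) * r x) * p x - ?T N x * p x) ^ 4 = (exp (- (c / 4) * r x) - ?T N x) ^ 4 * p x ^ 4"
        unfolding left_diff_distrib[symmetric] power_mult_distrib ..
      ultimately show ?case by (simp add: mult_ac)
    qed
  qed measurable
qed

text \<open>Boundedness on \<open>S\<close> is \<open>polynomial_le_exp\<close> at rate c / 4. On a
  polynomial \<open>p\<close> the product is exp (- t r) times the polynomial q p, so
  \<open>approximable_exp_times\<close> applies.\<close>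

lemma multiplier_polynomial_times_exp:
  assumes q: "real_polynomial_function q"
  shows "multiplier (\<lambda>x. q x * exp (- (c / 4) * r x))"
proof -
  obtain C where C: "0 \<le> C" "\<And>x. x \<in> S \<Longrightarrow> \<bar>q x\<bar> \<le> C * exp (c / 4 * r x)"
    using polynomial_le_exp[OF q, of "c / 4"] c_pos by auto
  note [measurable] = borel_measurable_real_polynomial_function[OF q]
    borel_measurable_real_polynomial_function[OF poly_r]
  show ?thesis
  proof (rule multiplierI[of _ C])
    show "AE x in \<rho>. \<bar>q x * exp (- (c / 4) * r x)\<bar> \<le> C"
      using AE_S
    proof eventually_elim
      case (elim x)
      have "\<bar>q x * exp (- (c / 4) * r x)\<bar> \<le> C * exp (c / 4 * r x) * exp (- (c / 4) * r x)"
        using C(2)[OF elim] by (simp add: abs_mult mult_right_mono)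
      also have "\<dots> = C" by (simp add: mult.assoc flip: exp_add)
      finally show ?case .
    qed
    fix p :: "real^'n \<Rightarrow> real" assume "real_polynomial_function p"
    hence "approximable (\<lambda>x. exp (- (c / 4) * r x) * (q x * p x))"
      using q by (intro approximable_exp_times) auto
    thus "approximable (\<lambda>x. q x * exp (- (c / 4) * r x) * p x)" by (simp add: mult_ac)
  qed (use C in measurable)
qed

lemma multiplier_indicator_halfspace: "multiplier (indicator {x. a < x $ i})"
proof -
  have "real_polynomial_function (\<lambda>x::real^'n. x $ i - a)"
    by (intro real_polynomial_function_diff real_polynomial_function_component
        real_polynomial_function.intros(2))
  from multiplier_indicator_pos[OF multiplier_polynomial_times_exp[OF this]]
  show ?thesis by (simp add: zero_less_mult_iff)
qed

lemma multiplier_indicator: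
  assumes "A \<in> sets borel"
  shows "multiplier (indicator A)"
proof -
  let ?G = "(\<lambda>(a, i). {x::real^'n. a < x \<bullet> i}) ` (UNIV \<times> Basis)"
  have "A \<in> sigma_sets UNIV ?G"
    using assms unfolding borel_eq_halfspace_greater by simp
  thus ?thesis
  proof induction
    case (Basic A)
    then obtain a i where "A = {x. a < x $ i}"
      by (auto simp: Basis_vec_def inner_axis)
    thus ?case using multiplier_indicator_halfspace by simp
  next
    case Empty
    show ?case using multiplier_const[of 0] by (simp add: indicator_def[abs_def])
  next
    case (Compl A)
    have "indicator (UNIV - A) = (\<lambda>x. 1 - indicator A x :: real)" by (auto simp: indicator_def)
    thus ?case using multiplier_diff[OF multiplier_const Compl.IH] by simp
  next
    case (Union A)
    \<comment> \<open>Finite unions are written with products of complements, so that the algebra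
      operations on multipliers apply; the countable union is their bounded limit.\<close>
    let ?w = "\<lambda>n x. 1 - (\<Prod>i<n. 1 - indicator (A i) x :: real)"
    have ind: "?w n x = indicator (\<Union>i<n. A i) x" for n x
      by (induction n) (auto simp: indicator_def lessThan_Suc)
    have m: "multiplier (?w n)" for n
      using Union.IH by (intro multiplier_diff multiplier_const multiplier_prod)
    have lim: "(\<lambda>n. ?w n x) \<longlonglongrightarrow> indicator (\<Union>i. A i) x" for x
      unfolding ind by (rule LIMSEQ_indicator_UN)
    show ?case
    proof (rule multiplier_bounded_limit[where w = ?w and B = 1])
      show "(indicator (\<Union>i. A i) :: real^'n \<Rightarrow> real) \<in> borel_measurable borel"
        using multiplier_measurable[OF m] by (intro borel_measurable_LIMSEQ_real[OF lim]) auto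
      show "AE x in \<rho>. \<bar>?w n x\<bar> \<le> 1" for n unfolding ind by (auto simp: indicator_def)
    qed (use m lim in \<open>auto simp: indicator_def\<close>)
  qed
qed

lemma approximable_indicator: "A \<in> sets borel \<Longrightarrow> approximable (indicator A)"
  using multiplier_indicator[of A] approximable_polynomial[of "\<lambda>_. 1"]
  unfolding multiplier_def by fastforce

lemma approximable_sum:
  "(\<And>i. i \<in> I \<Longrightarrow> approximable (f i)) \<Longrightarrow> approximable (\<lambda>x. \<Sum>i\<in>I. f i x)"
  by (induction I rule: infinite_finite_induct)
     (auto intro: approximable_add approximable_polynomial)

text \<open>Indicators of Borel sets lie in V, hence so do simple functions, and a dominated limit
  of simple functions reaches \<open>v\<close>.\<close>

theorem polynomials_dense_L4:
  assumes v: "v \<in> borel_measurable borel" and fin: "(\<integral>\<^sup>+x. ennreal (v x ^ 4) \<partial>\<rho>) < \<infinity>"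
  shows "approximable v"
proof -
  note [measurable] = v
  have "v \<in> borel_measurable \<rho>" by simp
  from borel_measurable_implies_sequence_metric[OF this, of 0] obtain s
    where s: "\<And>i. simple_function \<rho> (s i)" "\<And>x. (\<lambda>i. s i x) \<longlonglongrightarrow> v x"
      "\<And>i x. \<bar>s i x\<bar> \<le> 2 * \<bar>v x\<bar>" by auto
  show ?thesis
  \<comment> \<open>From |s i| \<le> 2 |v| follows |v - s i| \<le> 3 |v|, and 81 = 3^4.\<close>
  proof (rule approximable_dominated_limit[where w = s and F = "\<lambda>x. 81 * v x ^ 4"])
    show "approximable (s i)" for i
    proof -
      have fin: "finite (range (s i))" using s(1)[of i] by (simp add: simple_function_def)
      have m: "s i -` {y} \<in> sets borel" for y
        using simple_functionD(2)[OF s(1), of i "{y}"] by simp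
      have eq: "(\<lambda>x. \<Sum>y\<in>range (s i). y * indicator (s i -` {y}) x) = s i"
        using fin by (intro ext) (simp add: indicator_def)
      have "approximable (\<lambda>x. \<Sum>y\<in>range (s i). y * indicator (s i -` {y}) x)"
        using multiplier_const approximable_indicator[OF m]
        by (intro approximable_sum) (simp add: multiplier_def)
      thus ?thesis unfolding eq .
    qed
    show "(\<integral>\<^sup>+x. ennreal (81 * v x ^ 4) \<partial>\<rho>) < \<infinity>"
      using fin by (simp add: ennreal_mult nn_integral_cmult ennreal_mult_less_top)
    have "(v x - s i x) ^ 4 \<le> 81 * v x ^ 4" for i x
    proof -
      have "(v x - s i x) ^ 4 \<le> (3 * \<bar>v x\<bar>) ^ 4"
        using s(3)[of i x] by (intro power4_le_of_abs_le) linarith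
      thus ?thesis by (simp add: power_mult_distrib)
    qed
    thus "AE x in \<rho>. (v x - s i x) ^ 4 \<le> 81 * v x ^ 4" for i by simp
  qed (use s in auto)
qed

end

section \<open>Convergence of the relaxations\<close>

text \<open>Turns closeness of \<open>q\<close> and \<open>v\<close> in L^4 into closeness of their
  squares in L^2. The parameter \<open>t\<close> keeps the contribution of v^4 small at the price of
  a larger factor on (v - q)^4.\<close>

lemma square_diff_squares_le:
  fixes q v t :: real
  assumes t: "0 < t"
  shows "(q\<^sup>2 - v\<^sup>2)\<^sup>2 \<le> (2 + 4 / t) * (v - q) ^ 4 + 4 * t * v ^ 4"
proof -
  define X where "X = (v - q)\<^sup>2"
  have X: "0 \<le> X" by (simp add: X_def)
  have "(q\<^sup>2 - v\<^sup>2)\<^sup>2 = X * (q + v)\<^sup>2"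
    by (simp add: X_def power2_eq_square algebra_simps)
  also have "(q + v)\<^sup>2 \<le> 2 * X + 8 * v\<^sup>2"
  proof -
    \<comment> \<open>The difference of the two sides is exactly (q - 3 v)^2.\<close>
    have "0 \<le> (q - 3 * v)\<^sup>2" by simp
    thus ?thesis by (simp add: X_def power2_eq_square algebra_simps)
  qed
  hence "X * (q + v)\<^sup>2 \<le> X * (2 * X + 8 * v\<^sup>2)" using X by (rule mult_left_mono)
  also have "X * (2 * X + 8 * v\<^sup>2) \<le> (2 + 4 / t) * X\<^sup>2 + 4 * t * (v\<^sup>2)\<^sup>2"
  proof -
    \<comment> \<open>Young's inequality for the mixed term 8 X v^2.\<close>
    have "0 \<le> 4 / t * (X - t * v\<^sup>2)\<^sup>2" using t by simp
    also have "\<dots> = 4 / t * X\<^sup>2 - 8 * X * v\<^sup>2 + 4 * t * (v\<^sup>2)\<^sup>2"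
      using t by (simp add: power2_eq_square field_simps)
    finally show ?thesis by (simp add: power2_eq_square algebra_simps)
  qed
  finally show ?thesis by (simp add: X_def flip: power_mult)
qed

text \<open>Points are sorted by the first constraint they violate. The sum telescopes because the
  sets decrease in \<open>m\<close> and the one for m = 0 is the whole space.\<close>

lemma indicator_basic_semialg_telescope:
  "indicator (basic_semialg m g) x +
     (\<Sum>j=1..m. indicator (basic_semialg (j - 1) g - basic_semialg j g) x) = (1 :: real)"
proof (induction m)
  case 0
  thus ?case by (simp add: basic_semialg_def)
next
  case (Suc m)
  have "basic_semialg (Suc m) g \<subseteq> basic_semialg m g"
    by (auto simp: basic_semialg_def)
  hence "indicator (basic_semialg m g - basic_semialg (Suc m) g) x
      = (indicator (basic_semialg m g) x - indicator (basic_semialg (Suc m) g) x :: real)"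
    by (auto simp: indicator_def)
  thus ?case using Suc by simp
qed

lemma borel_measurable_poly_eval [measurable]: "poly_eval p \<in> borel_measurable borel"
  by (intro borel_measurable_real_polynomial_function real_polynomial_function_poly_eval)

lemma borel_measurable_monom_eval [measurable]: "monom_eval \<alpha> \<in> borel_measurable borel"
  by (intro borel_measurable_real_polynomial_function real_polynomial_function_monom_eval)

lemma sets_basic_semialg [measurable]: "basic_semialg m g \<in> sets borel"
  unfolding basic_semialg_def by measurable

context decaying_measure
begin

section \<open>Polynomial certificates\<close>

lemma integrable_polynomial: "real_polynomial_function p \<Longrightarrow> integrable \<mu> p"
  using integrable_polynomial_exp[of p 0] decay_pos by simp

lemma measurable_measure [simp]: "measurable \<mu> borel = measurable borel borel"
  by (intro measurable_cong_sets) auto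

lemma integrable_indicator_polynomial:
  assumes "A \<in> sets borel" "real_polynomial_function p"
  shows "integrable \<mu> (\<lambda>x. indicator A x * p x)"
  using integrable_mult_indicator[of A \<mu> p] assms integrable_polynomial by simp

text \<open>The weight \<gamma>^2 joins the polynomial factor, and \<kappa> / 2 < \<kappa> leaves
  enough decay for integrability.\<close>

lemma exponential_moments_square_density:
  assumes \<gamma>: "real_polynomial_function \<gamma>"
  shows "exponential_moments r S (density \<mu> (\<lambda>x. ennreal ((\<gamma> x)\<^sup>2))) (\<kappa> / 2)"
proof
  note [measurable] = borel_measurable_real_polynomial_function[OF \<gamma>]
  show "AE x in density \<mu> (\<lambda>x. ennreal ((\<gamma> x)\<^sup>2)). x \<in> S"
    using AE_in_S by (subst AE_density) auto
  fix p :: "real^'n \<Rightarrow> real" assume p: "real_polynomial_function p"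
  note [measurable] = borel_measurable_real_polynomial_function[OF p]
  have "integrable \<mu> (\<lambda>x. ((\<gamma> x)\<^sup>2 * p x) * exp (\<kappa> / 2 * r x))"
    using decay_pos by (intro integrable_polynomial_exp real_polynomial_function.intros(4)
        real_polynomial_function_power p \<gamma>) auto
  thus "integrable (density \<mu> (\<lambda>x. ennreal ((\<gamma> x)\<^sup>2))) (\<lambda>x. p x * exp (\<kappa> / 2 * r x))"
    by (subst integrable_density) (auto simp: mult.assoc)
qed (use decay_pos in auto)

text \<open>For v = f / sqrt (- \<gamma>) on \<open>B\<close>, and 0 elsewhere, the expression with
  \<open>v\<close> in place of \<open>q\<close> vanishes. Although \<open>v\<close> may blow up near
  the zeros of \<gamma>, the product \<gamma>^2 v^4 equals f^4 on \<open>B\<close>, so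
  \<open>v\<close> has a finite fourth moment under \<gamma>^2 \<mu>. A polynomial \<open>q\<close>
  close to \<open>v\<close> there leaves the error \<gamma> (q^2 - v^2), small in
  L^2(\<mu>).\<close>

lemma square_times_negative_approx:
  assumes B: "B \<in> sets borel" and \<gamma>: "real_polynomial_function \<gamma>" and neg: "\<And>x. x \<in> B \<Longrightarrow> \<gamma> x < 0"
    and f: "real_polynomial_function f" and \<epsilon>: "0 < \<epsilon>"
  obtains q where "real_polynomial_function q"
    "integrable \<mu> (\<lambda>x. ((f x)\<^sup>2 * indicator B x + (q x)\<^sup>2 * \<gamma> x)\<^sup>2)"
    "(\<integral>x. ((f x)\<^sup>2 * indicator B x + (q x)\<^sup>2 * \<gamma> x)\<^sup>2 \<partial>\<mu>) < \<epsilon>"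
proof -
  note [measurable] = B borel_measurable_real_polynomial_function[OF \<gamma>]
    borel_measurable_real_polynomial_function[OF f]
  define v where "v x = f x / sqrt (- \<gamma> x) * indicator B x" for x
  have [measurable]: "v \<in> borel_measurable borel" unfolding v_def by measurable
  have v2: "(v x)\<^sup>2 * \<gamma> x = - ((f x)\<^sup>2 * indicator B x)" for x
    using neg[of x] by (cases "x \<in> B") (auto simp: v_def power_divide)
  have v4: "(\<gamma> x)\<^sup>2 * v x ^ 4 = f x ^ 4 * indicator B x" for x
  proof -
    have "(\<gamma> x)\<^sup>2 * v x ^ 4 = ((v x)\<^sup>2 * \<gamma> x)\<^sup>2" by (simp add: power_mult_distrib flip: power_mult)
    also have "\<dots> = f x ^ 4 * indicator B x"
      unfolding v2 by (simp add: power_mult_distrib indicator_def flip: power_mult)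
    finally show ?thesis .
  qed
  interpret E: exponential_moments r S "density \<mu> (\<lambda>x. ennreal ((\<gamma> x)\<^sup>2))" "\<kappa> / 2"
    by (rule exponential_moments_square_density[OF \<gamma>])
  have f4: "integrable \<mu> (\<lambda>x. f x ^ 4)"
    by (intro integrable_polynomial real_polynomial_function_power f)
  have "(\<integral>\<^sup>+x. ennreal (v x ^ 4) \<partial>density \<mu> (\<lambda>x. ennreal ((\<gamma> x)\<^sup>2)))
      = (\<integral>\<^sup>+x. ennreal (f x ^ 4 * indicator B x) \<partial>\<mu>)"
    by (subst nn_integral_density) (auto simp: v4 simp flip: ennreal_mult)
  also have "\<dots> \<le> (\<integral>\<^sup>+x. ennreal (norm (f x ^ 4)) \<partial>\<mu>)"
    by (intro nn_integral_mono ennreal_leI) (auto simp: indicator_def)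
  also have "\<dots> < \<infinity>" using f4 unfolding integrable_iff_bounded by blast
  finally have "E.approximable v" by (intro E.polynomials_dense_L4) auto
  define F where "F = (\<integral>x. f x ^ 4 \<partial>\<mu>)"
  have F: "0 \<le> F" unfolding F_def by (intro integral_nonneg_AE) auto
  \<comment> \<open>First \<open>t\<close> brings the v^4 part of
    \<open>square_diff_squares_le\<close> below \<epsilon> / 2, then \<eta> does the same for the
    other part; F + 1 avoids dividing by 0.\<close>
  define t where "t = \<epsilon> / (8 * (F + 1))"
  have t: "0 < t" using F \<epsilon> by (simp add: t_def)
  have tF: "4 * t * F < \<epsilon> / 2" using F \<epsilon> by (simp add: t_def field_simps)
  define \<eta> where "\<eta> = \<epsilon> / (2 * (2 + 4 / t))"
  have \<eta>: "0 < \<eta>" using t \<epsilon> by (simp add: \<eta>_def add_pos_pos)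
  obtain q where q: "real_polynomial_function q" "E.dist4 v q < ennreal \<eta>"
    using \<open>E.approximable v\<close> \<eta> unfolding E.approximable_def by blast
  note [measurable] = borel_measurable_real_polynomial_function[OF q(1)]
  have "E.dist4 v q = (\<integral>\<^sup>+x. ennreal ((\<gamma> x)\<^sup>2 * (v x - q x) ^ 4) \<partial>\<mu>)"
    unfolding E.dist4_def by (subst nn_integral_density) (auto simp: ennreal_mult)
  hence nn: "(\<integral>\<^sup>+x. ennreal ((\<gamma> x)\<^sup>2 * (v x - q x) ^ 4) \<partial>\<mu>) < ennreal \<eta>" using q by simp
  have int: "integrable \<mu> (\<lambda>x. (\<gamma> x)\<^sup>2 * (v x - q x) ^ 4)"
    by (intro integrableI_nonneg) (use nn in \<open>auto intro: less_trans\<close>)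
  have "ennreal (\<integral>x. (\<gamma> x)\<^sup>2 * (v x - q x) ^ 4 \<partial>\<mu>) < ennreal \<eta>"
    using nn by (subst nn_integral_eq_integral[OF int, symmetric]) auto
  hence small: "(\<integral>x. (\<gamma> x)\<^sup>2 * (v x - q x) ^ 4 \<partial>\<mu>) < \<eta>"
    by (subst (asm) ennreal_less_iff) (auto intro!: integral_nonneg_AE)
  let ?a = "\<lambda>x. ((f x)\<^sup>2 * indicator B x + (q x)\<^sup>2 * \<gamma> x)\<^sup>2"
  let ?b = "\<lambda>x. (2 + 4 / t) * ((\<gamma> x)\<^sup>2 * (v x - q x) ^ 4) + 4 * t * f x ^ 4"
  have le: "?a x \<le> ?b x" for x
  proof -
    have "?a x = (\<gamma> x)\<^sup>2 * ((q x)\<^sup>2 - (v x)\<^sup>2)\<^sup>2"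
    proof -
      have "(f x)\<^sup>2 * indicator B x + (q x)\<^sup>2 * \<gamma> x = \<gamma> x * ((q x)\<^sup>2 - (v x)\<^sup>2)"
        using v2[of x] by (simp add: algebra_simps)
      thus ?thesis by (simp add: power_mult_distrib)
    qed
    also have "\<dots> \<le> (\<gamma> x)\<^sup>2 * ((2 + 4 / t) * (v x - q x) ^ 4 + 4 * t * v x ^ 4)"
      by (intro mult_left_mono square_diff_squares_le t) auto
    also have "\<dots> = (2 + 4 / t) * ((\<gamma> x)\<^sup>2 * (v x - q x) ^ 4) + 4 * t * (f x ^ 4 * indicator B x)"
      unfolding v4[symmetric] by (simp add: algebra_simps)
    also have "\<dots> \<le> ?b x" using t by (auto simp: indicator_def)
    finally show ?thesis .
  qed
  have ib: "integrable \<mu> ?b" using int f4 by (intro Bochner_Integration.integrable_add integrable_mult_right)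
  have ia: "integrable \<mu> ?a"
    by (rule Bochner_Integration.integrable_bound[OF ib]) (use le in \<open>auto intro!: order.trans[OF le]\<close>)
  have "(\<integral>x. ?a x \<partial>\<mu>) \<le> (\<integral>x. ?b x \<partial>\<mu>)" using ia ib le by (rule integral_mono)
  also have "\<dots> = (2 + 4 / t) * (\<integral>x. (\<gamma> x)\<^sup>2 * (v x - q x) ^ 4 \<partial>\<mu>) + 4 * t * F"
    using int f4 by (simp add: F_def)
  also have "\<dots> < (2 + 4 / t) * \<eta> + \<epsilon> / 2"
    using small t by (intro add_strict_mono tF mult_strict_left_mono) (auto simp: add_pos_pos)
  also have "\<dots> = \<epsilon>"
  proof -
    have "A * (\<epsilon> / (2 * A)) = \<epsilon> / 2" if "A \<noteq> 0" for A :: real using that by simp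
    moreover have "2 + 4 / t \<noteq> 0" using t by (simp add: add_pos_pos less_imp_neq[symmetric])
    ultimately show ?thesis unfolding \<eta>_def by fastforce
  qed
  finally show ?thesis using that q(1) ia by blast
qed

text \<open>\<open>square_times_negative_approx\<close> is applied to each set of the partition by
  first violated constraint, with \<gamma> = g_j, and to the feasible set itself with \<gamma> = -1,
  which produces -p^2. The indicators add up to 1, so the m + 1 errors add up to the polynomial in
  the first claim.\<close>

lemma positivity_certificate:
  fixes f :: "'n rpoly" and g :: "nat \<Rightarrow> 'n rpoly"
  assumes s: "0 < s"
  obtains p q where
    "(\<integral>x. (poly_eval (f * f - p * p + (\<Sum>j=1..m. q j * q j * g j)) x)\<^sup>2 \<partial>\<mu>) \<le> (real m + 1)\<^sup>2 * s\<^sup>2"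
    "(\<integral>x. (poly_eval p x)\<^sup>2 \<partial>\<mu>)
       \<le> (\<integral>x. indicator (basic_semialg m g) x * (poly_eval f x)\<^sup>2 \<partial>\<mu>) + s * (measure \<mu> UNIV + 1)"
proof -
  define \<gamma> where "\<gamma> j = (if j = 0 then (\<lambda>_. -1) else poly_eval (g j))" for j
  define B where "B j = (if j = 0 then basic_semialg m g else basic_semialg (j - 1) g - basic_semialg j g)" for j
  have B: "B j \<in> sets borel" for j by (simp add: B_def)
  have \<gamma>: "real_polynomial_function (\<gamma> j)" for j
    by (simp add: \<gamma>_def real_polynomial_function_poly_eval real_polynomial_function.intros(2))
  have neg: "\<gamma> j x < 0" if "x \<in> B j" for j x
  proof (cases j)
    case (Suc i)
    hence "\<not> (\<forall>l\<in>{1..Suc i}. 0 \<le> poly_eval (g l) x)" "\<forall>l\<in>{1..i}. 0 \<le> poly_eval (g l) x"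
      using that by (auto simp: B_def basic_semialg_def)
    hence "\<not> 0 \<le> poly_eval (g (Suc i)) x" by (metis atLeastAtMost_iff le_Suc_eq)
    thus ?thesis by (simp add: \<gamma>_def Suc)
  qed (simp add: \<gamma>_def)
  let ?a = "\<lambda>q j x. (poly_eval f x)\<^sup>2 * indicator (B j) x + (poly_eval (q j) x)\<^sup>2 * \<gamma> j x"
  have "\<exists>Q. integrable \<mu> (\<lambda>x. (?a (\<lambda>_. Q) j x)\<^sup>2) \<and> (\<integral>x. (?a (\<lambda>_. Q) j x)\<^sup>2 \<partial>\<mu>) < s\<^sup>2" for j
  proof -
    have s2: "0 < s\<^sup>2" using s by simp
    obtain h where h: "real_polynomial_function h"
      "integrable \<mu> (\<lambda>x. ((poly_eval f x)\<^sup>2 * indicator (B j) x + (h x)\<^sup>2 * \<gamma> j x)\<^sup>2)"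
      "(\<integral>x. ((poly_eval f x)\<^sup>2 * indicator (B j) x + (h x)\<^sup>2 * \<gamma> j x)\<^sup>2 \<partial>\<mu>) < s\<^sup>2"
      by (rule square_times_negative_approx[OF B \<gamma> neg real_polynomial_function_poly_eval s2])
    obtain Q where "h = poly_eval Q" using real_polynomial_function_imp_poly_eval[OF h(1)] by blast
    thus ?thesis using h by blast
  qed
  hence "\<exists>q. \<forall>j. integrable \<mu> (\<lambda>x. (?a q j x)\<^sup>2) \<and> (\<integral>x. (?a q j x)\<^sup>2 \<partial>\<mu>) < s\<^sup>2"
    by (intro choice allI)
  then obtain q where qi: "\<And>j. integrable \<mu> (\<lambda>x. (?a q j x)\<^sup>2)"
    and q: "\<And>j. (\<integral>x. (?a q j x)\<^sup>2 \<partial>\<mu>) < s\<^sup>2" by blast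
  let ?e = "f * f - q 0 * q 0 + (\<Sum>j=1..m. q j * q j * g j)"
  have e: "poly_eval ?e x = (\<Sum>j\<le>m. ?a q j x)" for x
  proof -
    have "(\<Sum>j\<le>m. ?a q j x) = ?a q 0 x + (\<Sum>j=1..m. ?a q j x)"
      by (simp add: sum.atMost_shift sum.atLeast1_atMost_eq)
    also have "(\<Sum>j=1..m. ?a q j x) = (\<Sum>j=1..m. (poly_eval f x)\<^sup>2
        * indicator (basic_semialg (j - 1) g - basic_semialg j g) x + (poly_eval (q j) x)\<^sup>2 * poly_eval (g j) x)"
      by (intro sum.cong) (auto simp: B_def \<gamma>_def)
    also have "?a q 0 x + \<dots> = (poly_eval f x)\<^sup>2 * (indicator (basic_semialg m g) x +
        (\<Sum>j=1..m. indicator (basic_semialg (j - 1) g - basic_semialg j g) x)) - (poly_eval (q 0) x)\<^sup>2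
        + (\<Sum>j=1..m. (poly_eval (q j) x)\<^sup>2 * poly_eval (g j) x)"
      by (simp add: B_def \<gamma>_def sum.distrib sum_distrib_left distrib_left)
    finally show ?thesis
      unfolding indicator_basic_semialg_telescope
      by (simp add: poly_eval_add poly_eval_diff poly_eval_mult poly_eval_sum power2_eq_square)
  qed
  \<comment> \<open>Cauchy-Schwarz for a sum of m + 1 terms.\<close>
  have "(\<integral>x. (poly_eval ?e x)\<^sup>2 \<partial>\<mu>) \<le> (\<integral>x. (real m + 1) * (\<Sum>j\<le>m. (?a q j x)\<^sup>2) \<partial>\<mu>)"
  proof (rule integral_mono)
    show "integrable \<mu> (\<lambda>x. (poly_eval ?e x)\<^sup>2)"
      by (intro integrable_polynomial real_polynomial_function_power real_polynomial_function_poly_eval)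
    show "integrable \<mu> (\<lambda>x. (real m + 1) * (\<Sum>j\<le>m. (?a q j x)\<^sup>2))"
      by (intro integrable_mult_right Bochner_Integration.integrable_sum qi)
    show "(poly_eval ?e x)\<^sup>2 \<le> (real m + 1) * (\<Sum>j\<le>m. (?a q j x)\<^sup>2)" for x
      unfolding e using sum_squared_le_sum_of_squares[of "\<lambda>j. ?a q j x" "{..m}"]
      by (simp add: mult.commute add.commute)
  qed
  also have "\<dots> = (real m + 1) * (\<Sum>j\<le>m. (\<integral>x. (?a q j x)\<^sup>2 \<partial>\<mu>))"
    by (simp only: integral_mult_right_zero Bochner_Integration.integral_sum[OF qi])
  also have "\<dots> \<le> (real m + 1) * (\<Sum>j\<le>m. s\<^sup>2)"
    using q by (intro mult_left_mono sum_mono less_imp_le) auto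
  also have "\<dots> = (real m + 1)\<^sup>2 * s\<^sup>2"
    by (simp add: power2_eq_square algebra_simps)
  finally have 1: "(\<integral>x. (poly_eval ?e x)\<^sup>2 \<partial>\<mu>) \<le> (real m + 1)\<^sup>2 * s\<^sup>2" .
  let ?K = "basic_semialg m g"
  have iK: "integrable \<mu> (\<lambda>x. indicator ?K x * (poly_eval f x)\<^sup>2)"
    by (intro integrable_indicator_polynomial real_polynomial_function_power
        real_polynomial_function_poly_eval sets_basic_semialg)
  have ic: "integrable \<mu> (\<lambda>_. s)"
    by (intro integrable_polynomial real_polynomial_function.intros(2))
  have "(\<integral>x. (poly_eval (q 0) x)\<^sup>2 \<partial>\<mu>)
      \<le> (\<integral>x. (indicator ?K x * (poly_eval f x)\<^sup>2 + s) + (1 / s) * (?a q 0 x)\<^sup>2 \<partial>\<mu>)"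
  proof (rule integral_mono)
    show "integrable \<mu> (\<lambda>x. (poly_eval (q 0) x)\<^sup>2)"
      by (intro integrable_polynomial real_polynomial_function_power real_polynomial_function_poly_eval)
    show "integrable \<mu> (\<lambda>x. (indicator ?K x * (poly_eval f x)\<^sup>2 + s) + (1 / s) * (?a q 0 x)\<^sup>2)"
      by (intro integrable_mult_right Bochner_Integration.integrable_add iK ic qi)
    fix x
    \<comment> \<open>With a = 1_K f^2 - p^2, where p = q 0, completing the square gives -a \<le> s
      + a^2 / s, so the L^2 bound on \<open>a\<close> controls the integral of p^2 = 1_K f^2 -
      a.\<close>
    have "0 \<le> (1 / s) * ((?a q 0 x) / 2 + s)\<^sup>2" using s by simp
    also have "\<dots> = (1 / s) * (?a q 0 x)\<^sup>2 / 4 + ?a q 0 x + s"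
      using s by (simp add: power2_eq_square field_simps)
    also have "\<dots> \<le> (1 / s) * (?a q 0 x)\<^sup>2 + ?a q 0 x + s"
      using s by (simp add: field_simps)
    finally show "(poly_eval (q 0) x)\<^sup>2
        \<le> (indicator ?K x * (poly_eval f x)\<^sup>2 + s) + (1 / s) * (?a q 0 x)\<^sup>2"
      by (simp add: B_def \<gamma>_def mult.commute)
  qed
  also have "\<dots> = (\<integral>x. indicator ?K x * (poly_eval f x)\<^sup>2 \<partial>\<mu>) + s * measure \<mu> UNIV
      + (1 / s) * (\<integral>x. (?a q 0 x)\<^sup>2 \<partial>\<mu>)"
    using iK ic qi[of 0] by (subst Bochner_Integration.integral_add) auto
  also have "\<dots> \<le> (\<integral>x. indicator ?K x * (poly_eval f x)\<^sup>2 \<partial>\<mu>) + s * measure \<mu> UNIV + (1 / s) * s\<^sup>2"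
    using q[of 0] s by (intro add_left_mono mult_left_mono) auto
  also have "\<dots> = (\<integral>x. indicator ?K x * (poly_eval f x)\<^sup>2 \<partial>\<mu>) + s * (measure \<mu> UNIV + 1)"
    using s by (simp add: power2_eq_square algebra_simps)
  finally show ?thesis using 1 that by blast
qed

section \<open>Moment sequences of weighted measures\<close>

lemma integrable_monom_eval: "integrable \<mu> (monom_eval \<alpha>)"
  by (intro integrable_polynomial real_polynomial_function_monom_eval)

lemma riesz_weighted_moments:
  assumes "\<And>\<alpha>. integrable \<mu> (\<lambda>x. w x * monom_eval \<alpha> x)"
  shows "riesz (\<lambda>\<alpha>. \<integral>x. w x * monom_eval \<alpha> x \<partial>\<mu>) p = (\<integral>x. w x * poly_eval p x \<partial>\<mu>)"
proof -
  have "(\<integral>x. w x * poly_eval p x \<partial>\<mu>)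
      = (\<integral>x. (\<Sum>\<alpha>\<in>Poly_Mapping.keys p. Poly_Mapping.lookup p \<alpha> * (w x * monom_eval \<alpha> x)) \<partial>\<mu>)"
    by (simp add: poly_eval_def sum_distrib_left mult_ac)
  also have "\<dots> = (\<Sum>\<alpha>\<in>Poly_Mapping.keys p. \<integral>x. Poly_Mapping.lookup p \<alpha> * (w x * monom_eval \<alpha> x) \<partial>\<mu>)"
    using assms by (intro Bochner_Integration.integral_sum integrable_mult_right)
  finally show ?thesis by (simp add: riesz_def)
qed

lemma riesz_moment: "riesz (moment \<mu>) p = (\<integral>x. poly_eval p x \<partial>\<mu>)"
  using riesz_weighted_moments[of "\<lambda>_. 1" p] integrable_monom_eval
  by (simp add: moment_def[abs_def])

text \<open>The quadratic form is the integral of \<open>w\<close> times the square of a combination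
  of monomials.\<close>

lemma psd_on_weighted_moment_matrix:
  assumes w: "\<And>x. 0 \<le> w x" and int: "\<And>\<alpha>. integrable \<mu> (\<lambda>x. w x * monom_eval \<alpha> x)"
  shows "psd_on I (moment_matrix (\<lambda>\<alpha>. \<integral>x. w x * monom_eval \<alpha> x \<partial>\<mu>))"
  unfolding psd_on_def
proof (intro conjI allI ballI)
  fix a :: "'n expo \<Rightarrow> real"
  let ?m = "\<lambda>\<alpha> \<beta> x. a \<alpha> * a \<beta> * (w x * monom_eval (\<alpha> + \<beta>) x)"
  have "(\<Sum>\<alpha>\<in>I. \<Sum>\<beta>\<in>I. a \<alpha> * moment_matrix (\<lambda>\<alpha>. \<integral>x. w x * monom_eval \<alpha> x \<partial>\<mu>) \<alpha> \<beta> * a \<beta>)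
      = (\<Sum>\<alpha>\<in>I. \<Sum>\<beta>\<in>I. \<integral>x. ?m \<alpha> \<beta> x \<partial>\<mu>)"
    by (simp add: moment_matrix_def mult_ac)
  also have "\<dots> = (\<integral>x. (\<Sum>\<alpha>\<in>I. \<Sum>\<beta>\<in>I. ?m \<alpha> \<beta> x) \<partial>\<mu>)"
    using int by (simp add: Bochner_Integration.integral_sum)
  also have "\<dots> = (\<integral>x. w x * (\<Sum>\<alpha>\<in>I. a \<alpha> * monom_eval \<alpha> x)\<^sup>2 \<partial>\<mu>)"
    by (simp add: power2_eq_square sum_product sum_distrib_left monom_eval_add mult_ac)
  also have "\<dots> \<ge> 0" using w by (intro integral_nonneg_AE) auto
  finally show "0 \<le> (\<Sum>\<alpha>\<in>I. \<Sum>\<beta>\<in>I.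
      a \<alpha> * moment_matrix (\<lambda>\<alpha>. \<integral>x. w x * monom_eval \<alpha> x \<partial>\<mu>) \<alpha> \<beta> * a \<beta>)" .
qed (simp add: moment_matrix_def add.commute)

text \<open>The true splitting of \<mu> along \<open>K\<close>. Its localizing matrix for g_j is the
  moment matrix with weight 1_K g_j, which is nonnegative by definition of \<open>K\<close>.\<close>

lemma relax_feasible_restriction:
  fixes g :: "nat \<Rightarrow> 'n rpoly" and m :: nat
  defines "K \<equiv> basic_semialg m g"
  shows "relax_feasible \<mu> m g d (\<lambda>\<alpha>. \<integral>x. indicator K x * monom_eval \<alpha> x \<partial>\<mu>)
    (\<lambda>\<alpha>. \<integral>x. indicator (- K) x * monom_eval \<alpha> x \<partial>\<mu>)"
  unfolding relax_feasible_def
proof (intro conjI ballI)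
  have [measurable]: "K \<in> sets borel" by (simp add: K_def)
  have int: "integrable \<mu> (\<lambda>x. indicator A x * monom_eval \<alpha> x)" if "A \<in> sets borel" for A \<alpha>
    by (intro integrable_indicator_polynomial that real_polynomial_function_monom_eval)
  fix \<alpha>
  have "(\<integral>x. indicator K x * monom_eval \<alpha> x \<partial>\<mu>) + (\<integral>x. indicator (- K) x * monom_eval \<alpha> x \<partial>\<mu>)
      = (\<integral>x. indicator K x * monom_eval \<alpha> x + indicator (- K) x * monom_eval \<alpha> x \<partial>\<mu>)"
    by (intro Bochner_Integration.integral_add[symmetric] int) auto
  also have "\<dots> = moment \<mu> \<alpha>"
    unfolding moment_def by (intro Bochner_Integration.integral_cong) (auto simp: indicator_def)
  finally show "(\<integral>x. indicator K x * monom_eval \<alpha> x \<partial>\<mu>)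
      + (\<integral>x. indicator (- K) x * monom_eval \<alpha> x \<partial>\<mu>) = moment \<mu> \<alpha>" .
next
  have K [measurable]: "K \<in> sets borel" "- K \<in> sets borel" by (auto simp: K_def)
  have int: "integrable \<mu> (\<lambda>x. indicator A x * monom_eval \<alpha> x)" if "A \<in> sets borel" for A \<alpha>
    by (intro integrable_indicator_polynomial that real_polynomial_function_monom_eval)
  show "psd_on (expo_upto d) (moment_matrix (\<lambda>\<alpha>. \<integral>x. indicator K x * monom_eval \<alpha> x \<partial>\<mu>))"
    "psd_on (expo_upto d) (moment_matrix (\<lambda>\<alpha>. \<integral>x. indicator (- K) x * monom_eval \<alpha> x \<partial>\<mu>))"
    by (intro psd_on_weighted_moment_matrix int K; simp)+
  fix j assume j: "j \<in> {1..m}"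
  have intg: "integrable \<mu> (\<lambda>x. (indicator K x * poly_eval (g j) x) * monom_eval \<alpha> x)" for \<alpha>
  proof -
    have "integrable \<mu> (\<lambda>x. indicator K x * (poly_eval (g j) x * monom_eval \<alpha> x))"
      by (intro integrable_indicator_polynomial K real_polynomial_function.intros(4)
          real_polynomial_function_poly_eval real_polynomial_function_monom_eval)
    thus ?thesis by (simp add: mult.assoc)
  qed
  have "(\<Sum>\<gamma>\<in>Poly_Mapping.keys (g j). Poly_Mapping.lookup (g j) \<gamma> *
      (\<integral>x. indicator K x * monom_eval (\<alpha> + \<gamma>) x \<partial>\<mu>))
    = (\<integral>x. (indicator K x * poly_eval (g j) x) * monom_eval \<alpha> x \<partial>\<mu>)" for \<alpha>
  proof -
    have "integrable \<mu> (\<lambda>x. (indicator K x * monom_eval \<alpha> x) * monom_eval \<gamma> x)" for \<gamma>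
      using int[OF K(1), of "\<alpha> + \<gamma>"] by (simp add: monom_eval_add mult.assoc)
    from riesz_weighted_moments[OF this, of "g j"]
    show ?thesis by (simp add: riesz_def monom_eval_add mult_ac)
  qed
  moreover have "psd_on (expo_upto (d - half_deg (g j)))
      (moment_matrix (\<lambda>\<alpha>. \<integral>x. (indicator K x * poly_eval (g j) x) * monom_eval \<alpha> x \<partial>\<mu>))"
    using j by (intro psd_on_weighted_moment_matrix intg) (auto simp: K_def basic_semialg_def indicator_def)
  ultimately show "psd_on (expo_upto (d - half_deg (g j)))
      (localizing_matrix (g j) (\<lambda>\<alpha>. \<integral>x. indicator K x * monom_eval \<alpha> x \<partial>\<mu>))"
    unfolding localizing_matrix_eq_moment_matrix by simp
qed

text \<open>Since u + v = y and L_v(p^2) \<ge> 0, the share of \<open>u\<close> cannot exceed the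
  full integral of p^2.\<close>

lemma riesz_square_le:
  assumes feas: "relax_feasible \<mu> m g d u v" and deg: "poly_deg p \<le> d"
  shows "riesz u (p * p) \<le> (\<integral>x. (poly_eval p x)\<^sup>2 \<partial>\<mu>)"
proof -
  have "0 \<le> riesz v (p * p)"
    using feas deg by (intro riesz_square_nonneg) (auto simp: relax_feasible_def)
  moreover have "riesz u (p * p) + riesz v (p * p) = riesz (moment \<mu>) (p * p)"
    using feas keys_square_subset_expo_upto[OF deg]
    unfolding riesz_def relax_feasible_def sum.distrib[symmetric] distrib_left[symmetric]
    by (intro sum.cong) auto
  ultimately show ?thesis by (simp add: riesz_moment poly_eval_mult power2_eq_square)
qed

text \<open>Once \<open>d\<close> exceeds the degrees in a fixed certificate, the certificate bounds
  L_u(f^2) uniformly over all feasible pairs. The error term L_u(e) is estimated by 0 \<le> L_u((e -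
  s)^2), with \<open>s\<close> matched to the L^2 size of \<open>e\<close>.\<close>

lemma riesz_le_certificate:
  assumes s: "0 < s"
  shows "\<forall>\<^sub>F d in sequentially. \<forall>u v. relax_feasible \<mu> m g d u v \<longrightarrow>
    riesz u (f * f) \<le> (\<integral>x. indicator (basic_semialg m g) x * (poly_eval f x)\<^sup>2 \<partial>\<mu>)
       + s * ((real m + 1)\<^sup>2 + 2 * measure \<mu> UNIV + 1)"
proof -
  obtain p q where
    pq: "(\<integral>x. (poly_eval (f * f - p * p + (\<Sum>j=1..m. q j * q j * g j)) x)\<^sup>2 \<partial>\<mu>) \<le> (real m + 1)\<^sup>2 * s\<^sup>2"
    "(\<integral>x. (poly_eval p x)\<^sup>2 \<partial>\<mu>)
       \<le> (\<integral>x. indicator (basic_semialg m g) x * (poly_eval f x)\<^sup>2 \<partial>\<mu>) + s * (measure \<mu> UNIV + 1)"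
    by (rule positivity_certificate[OF s])
  define e where "e = f * f - p * p + (\<Sum>j=1..m. q j * q j * g j)"
  define c :: "'n rpoly" where "c = Poly_Mapping.single 0 s"
  \<comment> \<open>From this order on, squares of \<open>p\<close>, \<open>e\<close> and
    \<open>e - c\<close> fit the moment matrices, and squares of \<open>q j\<close> fit the
    localizing matrix of \<open>g j\<close>.\<close>
  define N where "N = Max (insert (poly_deg p) (insert (poly_deg e) (insert (poly_deg (e - c))
      ((\<lambda>j. poly_deg (q j) + half_deg (g j)) ` {1..m}))))"
  show ?thesis
  proof (rule eventually_sequentiallyI[of N], intro allI impI)
    fix d u v assume d: "N \<le> d" and feas: "relax_feasible \<mu> m g d u v"
    have Nq: "N \<ge> poly_deg (q j) + half_deg (g j)" if "j \<in> {1..m}" for j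
      unfolding N_def using that by (intro Max_ge) auto
    have "N \<ge> poly_deg p" "N \<ge> poly_deg e" "N \<ge> poly_deg (e - c)"
      unfolding N_def by (rule Max_ge; simp)+
    hence dp: "poly_deg p \<le> d" and de: "poly_deg e \<le> d" and dec: "poly_deg (e - c) \<le> d"
      using d by auto
    have dq: "poly_deg (q j) \<le> d - half_deg (g j)" if "j \<in> {1..m}" for j
      using Nq[OF that] d by auto
    have q: "0 \<le> riesz u (q j * q j * g j)" if "j \<in> {1..m}" for j
      unfolding riesz_mult_localizing[of u "q j * q j"] using feas that
      by (intro riesz_square_nonneg[OF _ dq[OF that]])
         (auto simp: relax_feasible_def localizing_matrix_eq_moment_matrix)
    have "riesz u (1 * 1) \<le> (\<integral>x. (poly_eval (1 :: 'n rpoly) x)\<^sup>2 \<partial>\<mu>)"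
      by (rule riesz_square_le[OF feas]) simp
    hence one: "riesz u 1 \<le> measure \<mu> UNIV" by simp
    have "0 \<le> riesz u ((e - c) * (e - c))"
      using feas by (intro riesz_square_nonneg[OF _ dec]) (auto simp: relax_feasible_def)
    also have "(e - c) * (e - c) = e * e - c * e - c * e + c * (c * 1)"
      by (simp add: algebra_simps)
    also have "riesz u \<dots> = riesz u (e * e) - 2 * s * riesz u e + s\<^sup>2 * riesz u 1"
      unfolding c_def by (simp only: riesz_add riesz_diff riesz_scale) (simp add: power2_eq_square)
    finally have "2 * s * riesz u e \<le> riesz u (e * e) + s\<^sup>2 * riesz u 1" by simp
    also have "\<dots> \<le> (real m + 1)\<^sup>2 * s\<^sup>2 + s\<^sup>2 * measure \<mu> UNIV"
      using riesz_square_le[OF feas de] pq(1) one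
      by (intro add_mono mult_left_mono) (auto simp: e_def)
    finally have "s * (2 * riesz u e) \<le> s * (s * ((real m + 1)\<^sup>2 + measure \<mu> UNIV))"
      by (simp add: power2_eq_square algebra_simps)
    hence e2: "2 * riesz u e \<le> s * ((real m + 1)\<^sup>2 + measure \<mu> UNIV)"
      using s by simp
    have "0 \<le> s * ((real m + 1)\<^sup>2 + measure \<mu> UNIV)" using s by simp
    hence eb: "riesz u e \<le> s * ((real m + 1)\<^sup>2 + measure \<mu> UNIV)" using e2 by linarith
    have "riesz u (f * f) = riesz u e + riesz u (p * p) - (\<Sum>j=1..m. riesz u (q j * q j * g j))"
      by (simp add: e_def riesz_add riesz_diff riesz_sum)
    also have "\<dots> \<le> riesz u e + riesz u (p * p)"
      using q by (simp only: diff_le_eq le_add_same_cancel1) (rule sum_nonneg)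
    also have "\<dots> \<le> s * ((real m + 1)\<^sup>2 + measure \<mu> UNIV)
      + ((\<integral>x. indicator (basic_semialg m g) x * (poly_eval f x)\<^sup>2 \<partial>\<mu>) + s * (measure \<mu> UNIV + 1))"
      using eb riesz_square_le[OF feas dp] pq(2) by (intro add_mono) auto
    finally show "riesz u (f * f) \<le> (\<integral>x. indicator (basic_semialg m g) x * (poly_eval f x)\<^sup>2 \<partial>\<mu>)
       + s * ((real m + 1)\<^sup>2 + 2 * measure \<mu> UNIV + 1)"
      by (simp add: algebra_simps)
  qed
qed

section \<open>Suprema of the relaxations and their limit\<close>

lemma bdd_above_relax:
  assumes "poly_deg f \<le> d"
  shows "bdd_above {riesz u (f * f) | u v. relax_feasible \<mu> m g d u v}"
  using assms by (intro bdd_aboveI[of _ "\<integral>x. (poly_eval f x)\<^sup>2 \<partial>\<mu>"]) (auto intro: riesz_square_le)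

lemma relax_nonempty: "{riesz u h | u v. relax_feasible \<mu> m g d u v} \<noteq> {}"
  using relax_feasible_restriction[of m g d] by blast

text \<open>The left side is the objective value at the moments of \<mu> restricted to the
  semialgebraic set, a feasible choice.\<close>

lemma relax_sup_ge:
  assumes "poly_deg f \<le> d"
  shows "(\<integral>x. indicator (basic_semialg m g) x * (poly_eval f x)\<^sup>2 \<partial>\<mu>) \<le> relax_sup \<mu> m g d (f\<^sup>2)"
proof -
  let ?u = "\<lambda>\<alpha>. \<integral>x. indicator (basic_semialg m g) x * monom_eval \<alpha> x \<partial>\<mu>"
  have "(\<integral>x. indicator (basic_semialg m g) x * (poly_eval f x)\<^sup>2 \<partial>\<mu>) = riesz ?u (f * f)"
    by (subst riesz_weighted_moments)
       (auto simp: poly_eval_mult power2_eq_square intro!: integrable_indicator_polynomial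
         real_polynomial_function_monom_eval)
  also have "\<dots> \<le> relax_sup \<mu> m g d (f\<^sup>2)"
    unfolding relax_sup_def power2_eq_square using relax_feasible_restriction[of m g d]
    by (intro cSup_upper bdd_above_relax assms) blast
  finally show ?thesis .
qed

lemma relax_sup_antimono:
  assumes "poly_deg f \<le> d'" "d' \<le> d"
  shows "relax_sup \<mu> m g d (f\<^sup>2) \<le> relax_sup \<mu> m g d' (f\<^sup>2)"
  unfolding relax_sup_def power2_eq_square using relax_feasible_antimono[OF _ assms(2)]
  by (intro cSup_subset_mono bdd_above_relax assms relax_nonempty) blast

lemma relax_sup_tendsto:
  "(\<lambda>d. relax_sup \<mu> m g d (f\<^sup>2))
     \<longlonglongrightarrow> (\<integral>x. indicator (basic_semialg m g) x * (poly_eval f x)\<^sup>2 \<partial>\<mu>)"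
  (is "_ \<longlonglongrightarrow> ?I")
proof (rule order_tendstoI)
  fix a assume a: "a < ?I"
  show "\<forall>\<^sub>F d in sequentially. a < relax_sup \<mu> m g d (f\<^sup>2)"
    by (rule eventually_sequentiallyI[of "poly_deg f"]) (use a relax_sup_ge in \<open>blast intro: less_le_trans\<close>)
next
  fix a assume a: "?I < a"
  define C where "C = (real m + 1)\<^sup>2 + 2 * measure \<mu> UNIV + 1"
  have C: "0 < C" unfolding C_def by (intro add_nonneg_pos add_nonneg_nonneg) auto
  \<comment> \<open>The certificate error s C then uses up half of the gap between the limit and
    \<open>a\<close>.\<close>
  define s where "s = (a - ?I) / (2 * C)"
  have s: "0 < s" using a C by (simp add: s_def)
  have "s * C = (a - ?I) / 2" using C by (simp add: s_def)
  hence less: "?I + s * C < a" using a by (simp add: field_simps)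
  from riesz_le_certificate[OF s, of m g f, folded C_def]
  show "\<forall>\<^sub>F d in sequentially. relax_sup \<mu> m g d (f\<^sup>2) < a"
  proof eventually_elim
    case (elim d)
    have "relax_sup \<mu> m g d (f\<^sup>2) \<le> ?I + s * C"
      unfolding relax_sup_def power2_eq_square[of f] using elim
      by (intro cSup_least relax_nonempty) auto
    thus ?case using less by linarith
  qed
qed

text \<open>The integral of f^2 splits over \<Omega> and the pieces of its complement. Upper bounds
  that decrease to the integrals over the pieces become, after subtraction, lower bounds that
  increase to the integral over \<Omega>.\<close>

lemma complement_bounds:
  fixes f :: "'n rpoly" and s :: nat and mc :: "nat \<Rightarrow> nat" and gc :: "nat \<Rightarrow> nat \<Rightarrow> 'n rpoly"
  assumes \<Omega>: "\<Omega> \<in> sets borel"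
    and part: "AE x in \<mu>. indicator \<Omega> x + (\<Sum>l=1..s. indicator (basic_semialg (mc l) (gc l)) x) = (1 :: real)"
  defines "lb \<equiv> \<lambda>d. (\<integral>x. (poly_eval f x)\<^sup>2 \<partial>\<mu>) - (\<Sum>l=1..s. relax_sup \<mu> (mc l) (gc l) d (f\<^sup>2))"
  shows "mono_on {d. poly_deg f \<le> d} lb"
    and "\<And>d. poly_deg f \<le> d \<Longrightarrow> lb d \<le> (\<integral>x\<in>\<Omega>. (poly_eval f x)\<^sup>2 \<partial>\<mu>)"
    and "lb \<longlonglongrightarrow> (\<integral>x\<in>\<Omega>. (poly_eval f x)\<^sup>2 \<partial>\<mu>)"
proof -
  let ?f = "\<lambda>x. (poly_eval f x)\<^sup>2"
  let ?K = "\<lambda>l. basic_semialg (mc l) (gc l)"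
  have int: "integrable \<mu> (\<lambda>x. indicator A x * ?f x)" if "A \<in> sets borel" for A
    by (intro integrable_indicator_polynomial that real_polynomial_function_power
        real_polynomial_function_poly_eval)
  have [measurable]: "\<Omega> \<in> sets borel" by fact
  have "(\<integral>x. ?f x \<partial>\<mu>) = (\<integral>x. indicator \<Omega> x * ?f x + (\<Sum>l=1..s. indicator (?K l) x * ?f x) \<partial>\<mu>)"
  proof (rule integral_cong_AE)
    show "AE x in \<mu>. ?f x = indicator \<Omega> x * ?f x + (\<Sum>l=1..s. indicator (?K l) x * ?f x)"
      using part
    proof eventually_elim
      case (elim x)
      show ?case unfolding sum_distrib_right[symmetric] distrib_right[symmetric] elim by simp
    qed
  qed auto
  also have "\<dots> = (\<integral>x. indicator \<Omega> x * ?f x \<partial>\<mu>) + (\<Sum>l=1..s. \<integral>x. indicator (?K l) x * ?f x \<partial>\<mu>)"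
    by (subst Bochner_Integration.integral_add, (intro int \<Omega> sets_basic_semialg Bochner_Integration.integrable_sum)+,
        subst Bochner_Integration.integral_sum, (intro int sets_basic_semialg)+, rule refl)
  finally have eq: "(\<integral>x\<in>\<Omega>. ?f x \<partial>\<mu>) = (\<integral>x. ?f x \<partial>\<mu>) - (\<Sum>l=1..s. \<integral>x. indicator (?K l) x * ?f x \<partial>\<mu>)"
    by (simp add: set_lebesgue_integral_def)
  show "mono_on {d. poly_deg f \<le> d} lb"
    unfolding lb_def by (intro mono_onI diff_left_mono sum_mono relax_sup_antimono) auto
  show "lb d \<le> (\<integral>x\<in>\<Omega>. ?f x \<partial>\<mu>)" if "poly_deg f \<le> d" for d
    unfolding lb_def eq using that by (intro diff_left_mono sum_mono relax_sup_ge)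
  show "lb \<longlonglongrightarrow> (\<integral>x\<in>\<Omega>. ?f x \<partial>\<mu>)"
    unfolding lb_def eq by (intro tendsto_intros relax_sup_tendsto)
qed

end

section \<open>The Gaussian and exponential measures\<close>

lemma decaying_measure_gaussian:
  "decaying_measure (\<lambda>x. (norm x)\<^sup>2) UNIV (gaussian_measure :: (real^'n::finite) measure)
     ((2 * pi) powr (- real CARD('n) / 2)) (1 / 2)"
proof
  have "(\<lambda>x::real^'n. (norm x)\<^sup>2) = (\<lambda>x. \<Sum>i\<in>UNIV. (x $ i)\<^sup>2)"
    by (simp add: norm_vec_def L2_set_def sum_nonneg)
  thus "real_polynomial_function (\<lambda>x::real^'n. (norm x)\<^sup>2)"
    by (simp add: real_polynomial_function_sum real_polynomial_function_power
        real_polynomial_function_component)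
  show "\<bar>x $ i\<bar> \<le> 1 + (norm x)\<^sup>2" for x :: "real^'n" and i
  proof -
    have "\<bar>x $ i\<bar> \<le> norm x" by (rule component_le_norm_cart)
    also have "norm x \<le> 1 + (norm x)\<^sup>2"
    proof (cases "norm x \<le> 1")
      case False
      hence "norm x * 1 \<le> norm x * norm x" by (intro mult_left_mono) auto
      thus ?thesis by (simp add: power2_eq_square)
    qed (simp add: add_increasing2)
    finally show ?thesis .
  qed
qed (auto simp: gaussian_measure_def)

lemma decaying_measure_exponential:
  "decaying_measure (\<lambda>x. \<Sum>i\<in>UNIV. x $ i) nonneg_orthant (exponential_measure :: (real^'n::finite) measure)
     ((2 * pi) powr (- real CARD('n) / 2)) 1"
proof
  show "real_polynomial_function (\<lambda>x::real^'n. \<Sum>i\<in>UNIV. x $ i)"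
    by (simp add: real_polynomial_function_sum real_polynomial_function_component)
  show "\<bar>x $ i\<bar> \<le> 1 + (\<Sum>i\<in>UNIV. x $ i)" if "x \<in> nonneg_orthant" for x :: "real^'n" and i
  proof -
    have "x $ i \<le> (\<Sum>i\<in>UNIV. x $ i)"
      using that by (intro member_le_sum) (auto simp: nonneg_orthant_def)
    thus ?thesis using that by (simp add: nonneg_orthant_def)
  qed
  have orth: "nonneg_orthant = (\<Inter>i. {x::real^'n. 0 \<le> x $ i})"
    by (auto simp: nonneg_orthant_def)
  show "(nonneg_orthant :: (real^'n) set) \<in> sets borel"
    unfolding orth by (intro borel_closed closed_INT ballI closed_Collect_le continuous_intros)
qed (auto simp: exponential_measure_def nonneg_orthant_def sum_nonneg)

text \<open>Off finitely many null sets a point of \<open>T\<close> lies in at most one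
  \<open>K l\<close>, and in none exactly when it lies in \<Omega>.\<close>

lemma indicator_partition_AE:
  fixes \<mu> :: "'a measure" and s :: nat
  assumes supp: "AE x in \<mu>. x \<in> T"
    and cover: "sym_diff (T - \<Omega>) (\<Union>l\<in>{1..s}. K l) \<in> null_sets \<mu>"
    and overlap: "\<And>l k. l \<in> {1..s} \<Longrightarrow> k \<in> {1..s} \<Longrightarrow> l \<noteq> k \<Longrightarrow> K l \<inter> K k \<in> null_sets \<mu>"
  shows "AE x in \<mu>. indicator \<Omega> x + (\<Sum>l=1..s. indicator (K l) x) = (1 :: real)"
proof -
  have "AE x in \<mu>. \<forall>l\<in>{1..s}. \<forall>k\<in>{1..s}. l \<noteq> k \<longrightarrow> x \<notin> K l \<inter> K k"
    by (intro AE_finite_allI finite_atLeastAtMost AE_impI AE_not_in overlap)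
  moreover note AE_not_in[OF cover] supp
  ultimately show ?thesis
  proof eventually_elim
    case (elim x)
    have iff: "x \<in> \<Omega> \<longleftrightarrow> \<not> (\<exists>l\<in>{1..s}. x \<in> K l)" using elim(2,3) by blast
    show ?case
    proof (cases "\<exists>l\<in>{1..s}. x \<in> K l")
      case True
      then obtain l where l: "l \<in> {1..s}" "x \<in> K l" by blast
      have "(\<Sum>k=1..s. indicator (K k) x) = (\<Sum>k=1..s. if k = l then 1 else 0 :: real)"
        using l elim(1) by (intro sum.cong) (auto simp: indicator_def)
      thus ?thesis using l iff by auto
    next
      case False
      hence "(\<Sum>k=1..s. indicator (K k) x) = (0 :: real)" by (intro sum.neutral) auto
      thus ?thesis using False iff by simp
    qed
  qed
qed

section \<open>Lower bounds for measure and integrals on \<Omega>\<close>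

theorem corollary2p5:
  fixes \<mu> :: "(real^'n::finite) measure"
    and m :: nat and g :: "nat \<Rightarrow> 'n rpoly"
    and s :: nat and mc :: "nat \<Rightarrow> nat" and gc :: "nat \<Rightarrow> nat \<Rightarrow> 'n rpoly"
    and \<Omega> \<Omega>c :: "(real^'n) set" and \<Omega>cl :: "nat \<Rightarrow> (real^'n) set" and d0 :: nat
  assumes mu: "\<mu> = gaussian_measure \<or>
               (\<mu> = exponential_measure \<and> (\<forall>i. \<exists>j\<in>{1..m}. g j = poly_var i))"
    and Omega: "\<Omega> = basic_semialg m g"
    and Omegac: "\<Omega>c = measure_supp \<mu> - \<Omega>"
    and int_Omega: "interior \<Omega> \<noteq> {}"
    and int_Omegac: "interior \<Omega>c \<noteq> {}"
    and Omegacl: "\<And>l. l \<in> {1..s} \<Longrightarrow> \<Omega>cl l = basic_semialg (mc l) (gc l)"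
    and subset: "\<And>l. l \<in> {1..s} \<Longrightarrow> \<Omega>cl l \<subseteq> measure_supp \<mu>"
    and cover: "sym_diff \<Omega>c (\<Union>l\<in>{1..s}. \<Omega>cl l) \<in> null_sets \<mu>"
    and overlap: "\<And>l k. l \<in> {1..s} \<Longrightarrow> k \<in> {1..s} \<Longrightarrow> l \<noteq> k \<Longrightarrow> \<Omega>cl l \<inter> \<Omega>cl k \<in> null_sets \<mu>"
    and d0: "d0 = Max (insert 0 {half_deg (gc l j) | l j. l \<in> {1..s} \<and> j \<in> {1..mc l}})"
  shows
    "(let lb = (\<lambda>d. measure \<mu> UNIV - (\<Sum>l=1..s. relax_sup \<mu> (mc l) (gc l) d 1)) in
        mono_on {d. d \<ge> d0} lb \<and>
        (\<forall>d\<ge>d0. measure \<mu> \<Omega> \<ge> lb d) \<and>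
        lb \<longlonglongrightarrow> measure \<mu> \<Omega>) \<and>
     (\<forall>f :: 'n rpoly. f \<noteq> 1 \<longrightarrow> (\<forall>x\<in>frontier \<Omega>. poly_eval f x = 0) \<longrightarrow>
       (let lb = (\<lambda>d. (\<integral>x. (poly_eval f x)\<^sup>2 \<partial>\<mu>) -
                      (\<Sum>l=1..s. relax_sup \<mu> (mc l) (gc l) d (f\<^sup>2))) in
          mono_on {d. d \<ge> d0 \<and> d \<ge> poly_deg f} lb \<and>
          (\<forall>d. d \<ge> d0 \<and> d \<ge> poly_deg f \<longrightarrow> (\<integral>x\<in>\<Omega>. (poly_eval f x)\<^sup>2 \<partial>\<mu>) \<ge> lb d) \<and>
          lb \<longlonglongrightarrow> (\<integral>x\<in>\<Omega>. (poly_eval f x)\<^sup>2 \<partial>\<mu>)))"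
proof -
  \<comment> \<open>The support serves as \<open>S\<close> in both cases, so \<Omega>c is the
    complement of \<Omega> within the set that carries \<mu>.\<close>
  obtain r k \<kappa> where dm: "decaying_measure r (measure_supp \<mu>) \<mu> k \<kappa>"
    using mu decaying_measure_gaussian decaying_measure_exponential
    by (metis measure_supp_gaussian measure_supp_exponential)
  interpret decaying_measure r "measure_supp \<mu>" \<mu> k \<kappa> by (fact dm)
  have \<Omega>: "\<Omega> \<in> sets borel" by (simp add: Omega)
  have "AE x in \<mu>. indicator \<Omega> x + (\<Sum>l=1..s. indicator (\<Omega>cl l) x) = (1 :: real)"
    using AE_in_S cover overlap unfolding Omegac by (rule indicator_partition_AE)
  moreover have "(\<Sum>l=1..s. indicator (\<Omega>cl l) x) = (\<Sum>l=1..s. indicator (basic_semialg (mc l) (gc l)) x :: real)" for x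
    using Omegacl by (intro sum.cong) auto
  ultimately have part: "AE x in \<mu>. indicator \<Omega> x
      + (\<Sum>l=1..s. indicator (basic_semialg (mc l) (gc l)) x) = (1 :: real)" by simp
  note bounds = complement_bounds[OF \<Omega> part]
  have one: "(\<integral>x\<in>\<Omega>. (poly_eval (1 :: 'n rpoly) x)\<^sup>2 \<partial>\<mu>) = measure \<mu> \<Omega>"
    by (simp add: set_lebesgue_integral_def)
  \<comment> \<open>Part (a) is the case f = 1, whose degree 0 imposes no condition on
    \<open>d\<close>.\<close>
  have a: "mono_on {d. d0 \<le> d} (\<lambda>d. measure \<mu> UNIV - (\<Sum>l=1..s. relax_sup \<mu> (mc l) (gc l) d 1))"
    "\<And>d. measure \<mu> UNIV - (\<Sum>l=1..s. relax_sup \<mu> (mc l) (gc l) d 1) \<le> measure \<mu> \<Omega>"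
    "(\<lambda>d. measure \<mu> UNIV - (\<Sum>l=1..s. relax_sup \<mu> (mc l) (gc l) d 1)) \<longlonglongrightarrow> measure \<mu> \<Omega>"
    using bounds[where f = 1] unfolding one by (auto intro: mono_on_subset)
  have b: "mono_on {d. d0 \<le> d \<and> poly_deg f \<le> d} (\<lambda>d. (\<integral>x. (poly_eval f x)\<^sup>2 \<partial>\<mu>) -
      (\<Sum>l=1..s. relax_sup \<mu> (mc l) (gc l) d (f\<^sup>2)))" for f
    by (rule mono_on_subset[OF bounds(1)]) auto
  show ?thesis using a b bounds(2,3) by (simp add: Let_def)
qed

end
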